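(* Let $\beta,c\in\mathbb{C}$ with $c\notin[0,\infty)$ and $-\beta\notin\{0,1,2,\dots\}$. Then the monic Meixner polynomials satisfy, for every $n\in\{0,1,2,\dots\}$ and every integer $m$ with $0\le m<n$, $$\int_{C}M_n(z;\beta,c)\,z^m\,\Gamma(-z)\Gamma(\beta+z)(-c)^z\,dz=0,$$ where $C$ is a complex contour from $-\infty i$ to $\infty i$ separating the increasing poles $\{0,1,2,\dots\}$ from the decreasing poles $\{-\beta,-\beta-1,-\beta-2,\dots\}$.
   Context: $(a)_0=1$, $(a)_n=a(a+1)\cdots(a+n-1)$. Monic Meixner polynomials are $$M_n(x;\beta,c)=\frac{c^n(\beta)_n}{(c-1)^n}\,{}_2F_1\!\left(\begin{array}{c}-n,\ -x\\ \beta\end{array}\Big|1-\frac1c\right).$$ $(-c)^z=e^{z\log(-c)}$ with the principal branch of the logarithm ($-c\notin(-\infty,0]$). The contour $C$ may be taken as the imaginary axis deformed in a bounded region, with the increasing poles to its right and the decreasing poles to its left. *)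

theory Defs
  imports "HOL-Complex_Analysis.Complex_Analysis"
begin

definition hypergeom_2F1 :: "complex \<Rightarrow> complex \<Rightarrow> complex \<Rightarrow> complex \<Rightarrow> complex" where
  "hypergeom_2F1 a b c z =
     (\<Sum>k. pochhammer a k * pochhammer b k / (pochhammer c k * fact k) * z ^ k)"

text \<open>The series below terminates because its first parameter is \<open>- n\<close>.\<close>

definition meixner :: "nat \<Rightarrow> complex \<Rightarrow> complex \<Rightarrow> complex \<Rightarrow> complex" where
  "meixner n \<beta> c x =
     c ^ n * pochhammer \<beta> n / (c - 1) ^ n * hypergeom_2F1 (- of_nat n) (- x) \<beta> (1 - 1 / c)"

text \<open>
  A contour from \<open>-i\<infinity>\<close> to \<open>i\<infinity>\<close> is the upward oriented imaginary axis, deformed in a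
  bounded region. The deformed part need not be simple.
\<close>

definition vertical_contour :: "(real \<Rightarrow> complex) \<Rightarrow> bool" where
  "vertical_contour \<gamma> \<longleftrightarrow>
     \<gamma> piecewise_C1_differentiable_on UNIV \<and>
     (\<exists>R. \<forall>t. \<bar>t\<bar> \<ge> R \<longrightarrow> \<gamma> t = \<i> * of_real t)"

text \<open>
  A point lies to the left (right) of such a contour if it can be joined, off the contour, to
  the far negative (positive) real axis. For a simple contour these are the two components of
  the complement. In particular, such a point does not lie on the contour.
\<close>

definition left_of_contour :: "(real \<Rightarrow> complex) \<Rightarrow> complex \<Rightarrow> bool" where
  "left_of_contour \<gamma> p \<longleftrightarrow>
     (\<forall>\<^sub>F x in at_bot. connected_component (- range \<gamma>) p (complex_of_real x))"

definition right_of_contour :: "(real \<Rightarrow> complex) \<Rightarrow> complex \<Rightarrow> bool" where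
  "right_of_contour \<gamma> p \<longleftrightarrow>
     (\<forall>\<^sub>F x in at_top. connected_component (- range \<gamma>) p (complex_of_real x))"

definition separating_contour :: "complex \<Rightarrow> (real \<Rightarrow> complex) \<Rightarrow> bool" where
  "separating_contour \<beta> \<gamma> \<longleftrightarrow>
     vertical_contour \<gamma> \<and>
     (\<forall>k::nat. right_of_contour \<gamma> (of_nat k)) \<and>
     (\<forall>k::nat. left_of_contour \<gamma> (- \<beta> - of_nat k))"

text \<open>
  The analogue of \<^const>\<open>has_contour_integral\<close> for curves parametrised by the whole real line;
  it includes convergence of the improper integral. At the finitely many points where \<open>\<gamma>\<close> is not
  differentiable the value of \<^const>\<open>vector_derivative\<close> is irrelevant.
\<close>

definition has_line_contour_integral ::
    "(complex \<Rightarrow> complex) \<Rightarrow> complex \<Rightarrow> (real \<Rightarrow> complex) \<Rightarrow> bool" where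
  "has_line_contour_integral f I \<gamma> \<longleftrightarrow>
     ((\<lambda>t. f (\<gamma> t) * vector_derivative \<gamma> (at t)) has_integral I) UNIV"

end

theory Submission imports Defs begin

text \<open>
  The weight \<open>w z = \<Gamma>(- z) \<Gamma>(\<beta> + z) (- c)\<^sup>z\<close> satisfies \<open>(z + 1) w (z + 1) = c (\<beta> + z) w z\<close>.
  For a polynomial \<open>p\<close>, the function \<open>h z = z p z w z\<close> has its poles at \<open>1, 2, \<dots>\<close> and
  \<open>- \<beta>, - \<beta> - 1, \<dots>\<close>, none of which lies between \<open>C\<close> and \<open>C + 1\<close>; so the integral of
  \<open>h z - h (z + 1)\<close> along \<open>C\<close> vanishes, which says that the moment functional \<open>J\<close> of \<open>w\<close> kills
  \<open>z p z - c (\<beta> + z) p (z + 1)\<close>. Taking for \<open>p\<close> products of rising factorials gives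
  \<open>J ((- z)\<^sub>k (\<beta> + z)\<^sub>j) = (c / (c - 1))\<^sup>k (\<beta> + j)\<^sub>k J ((\<beta> + z)\<^sub>j)\<close>, and \<open>J (M\<^sub>n (\<beta> + z)\<^sub>j)\<close>
  becomes, up to a factor, the \<open>n\<close>-th finite difference of a polynomial of degree \<open>j < n\<close>.

  Convergence needs \<open>\<Gamma>(x + i y) = O(exp (- \<theta> \<bar>y\<bar>))\<close> in vertical strips for every \<open>\<theta> < \<pi> / 2\<close>.
  For \<open>x = 1\<close> this is the reflection formula; it carries over to other \<open>x\<close> because
  \<open>\<bar>\<Gamma>(x + i y)\<bar> / \<Gamma>(x)\<close> increases with \<open>x\<close>, as the Gauss product shows factor by factor.
\<close>

section \<open>Finite differences and the Meixner sum\<close>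

text \<open>Both terms share the factor \<open>pochhammer (b + 1) m\<close>, and the remaining
  factors \<open>b\<close> and \<open>b + 1 + m\<close> differ by a constant. So one difference
  lowers the degree by one.\<close>

lemma pochhammer_diff_plus_one:
  fixes b :: "'a::comm_ring_1"
  shows "pochhammer b (Suc m) - pochhammer (b + 1) (Suc m) = - of_nat (Suc m) * pochhammer (b + 1) m"
proof -
  have "pochhammer b (Suc m) = b * pochhammer (b + 1) m" by (rule pochhammer_rec)
  moreover have "pochhammer (b + 1) (Suc m) = (b + 1 + of_nat m) * pochhammer (b + 1) m"
    by (simp add: pochhammer_Suc mult.commute)
  ultimately show ?thesis by (simp add: algebra_simps)
qed

text \<open>Pascal's rule on the weights moves one difference from the binomial coefficients to
  \<open>f\<close>.\<close>

lemma alternating_sum_Suc_binomial: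
  fixes f :: "nat \<Rightarrow> 'a::comm_ring_1"
  shows "(\<Sum>k\<le>Suc n. (-1) ^ k * of_nat (Suc n choose k) * f k)
       = (\<Sum>k\<le>n. (-1) ^ k * of_nat (n choose k) * (f k - f (Suc k)))"
proof -
  have "(\<Sum>k\<le>Suc n. (-1) ^ k * of_nat (Suc n choose k) * f k)
      = f 0 + (\<Sum>k\<le>n. (-1) ^ Suc k * of_nat (n choose k) * f (Suc k))
            + (\<Sum>k\<le>n. (-1) ^ Suc k * of_nat (n choose Suc k) * f (Suc k))"
    by (subst sum.atMost_Suc_shift) (simp add: ring_distribs sum.distrib sum_subtractf sum_negf add.assoc)
  also have "f 0 + (\<Sum>k\<le>n. (-1) ^ Suc k * of_nat (n choose k) * f (Suc k))
            + (\<Sum>k\<le>n. (-1) ^ Suc k * of_nat (n choose Suc k) * f (Suc k))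
      = (\<Sum>k\<le>Suc n. (-1) ^ k * of_nat (n choose k) * f k)
        - (\<Sum>k\<le>n. (-1) ^ k * of_nat (n choose k) * f (Suc k))"
    by (subst sum.atMost_Suc_shift) (simp add: sum_negf)
  finally show ?thesis by (simp add: right_diff_distrib sum_subtractf binomial_eq_0)
qed

text \<open>The rising factorial is a polynomial of degree \<open>m\<close> in \<open>k\<close>, and
  \<open>n > m\<close> successive differences kill it. The base point is generalised because each
  difference moves it to \<open>b + 1\<close>.\<close>

lemma alternating_sum_pochhammer_eq_0:
  fixes b :: "'a::comm_ring_1"
  assumes "m < n"
  shows "(\<Sum>k\<le>n. (-1) ^ k * of_nat (n choose k) * pochhammer (b + of_nat k) m) = 0"
  using assms
proof (induction n arbitrary: m b)
  case (Suc n)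
  show ?case
  proof (cases m)
    case 0
    then show ?thesis by (simp only: alternating_sum_Suc_binomial) simp
  next
    case (Suc m')
    have "(\<Sum>k\<le>Suc n. (-1) ^ k * of_nat (Suc n choose k) * pochhammer (b + of_nat k) m)
       = (\<Sum>k\<le>n. (-1) ^ k * of_nat (n choose k) *
            (- of_nat (Suc m') * pochhammer (b + 1 + of_nat k) m'))"
      using pochhammer_diff_plus_one[of "b + of_nat _" m']
      by (simp only: alternating_sum_Suc_binomial Suc) (simp add: add_ac)
    also have "\<dots> = - of_nat (Suc m') *
        (\<Sum>k\<le>n. (-1) ^ k * of_nat (n choose k) * pochhammer (b + 1 + of_nat k) m')"
      by (subst sum_distrib_left) (simp only: mult_ac)
    also have "\<dots> = 0" using Suc.IH[of m' "b + 1"] Suc Suc.prems by simp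
    finally show ?thesis .
  qed
qed simp

text \<open>The factor \<open>pochhammer (- of_nat n) k\<close> is a signed binomial coefficient
  times \<open>fact k\<close>, zero for \<open>k > n\<close>. In the resulting finite sum
  \<open>z\<close> enters only through \<open>pochhammer (- z) k\<close>, the basis on which the
  moment functional is explicit.\<close>

lemma meixner_eq_sum:
  assumes "c \<noteq> 0" "c \<noteq> 1"
  shows "meixner n \<beta> c z = (\<Sum>k\<le>n. c ^ n * pochhammer \<beta> n / (c - 1) ^ n *
      ((-1) ^ k * of_nat (n choose k) / pochhammer \<beta> k * ((c - 1) / c) ^ k) * pochhammer (- z) k)"
proof -
  have "hypergeom_2F1 (- of_nat n) (- z) \<beta> (1 - 1 / c) =
    (\<Sum>k\<le>n. pochhammer (- of_nat n) k * pochhammer (- z) k / (pochhammer \<beta> k * fact k) * (1 - 1 / c) ^ k)"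
    unfolding hypergeom_2F1_def
    by (rule suminf_finite) (auto simp: pochhammer_of_nat_eq_0_iff)
  also have "\<dots> = (\<Sum>k\<le>n. ((-1) ^ k * of_nat (n choose k) / pochhammer \<beta> k * ((c - 1) / c) ^ k) * pochhammer (- z) k)"
  proof (rule sum.cong[OF refl])
    fix k
    have *: "(1 - 1 / c) = (c - 1) / c" using assms by (simp add: field_simps)
    have "pochhammer (- of_nat n) k = (-1 :: complex) ^ k * (of_nat n gchoose k) * fact k"
      by (simp add: gbinomial_pochhammer)
    then show "pochhammer (- of_nat n) k * pochhammer (- z) k / (pochhammer \<beta> k * fact k) * (1 - 1 / c) ^ k
      = ((-1) ^ k * of_nat (n choose k) / pochhammer \<beta> k * ((c - 1) / c) ^ k) * pochhammer (- z) k"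
      unfolding * by (simp add: binomial_gbinomial)
  qed
  finally show ?thesis
    unfolding meixner_def by (simp add: sum_distrib_left mult_ac)
qed

section \<open>Decay of the Gamma function in vertical strips\<close>

lemma norm_Gamma_ratio_mono:
  fixes x X y :: real
  assumes "0 < x" "x \<le> X"
  shows "norm (Gamma (Complex x y)) / Gamma x \<le> norm (Gamma (Complex X y)) / Gamma X"
proof -
  \<comment> \<open>The factorials cancel and the power of \<open>n\<close> with exponent
    \<open>a + iy\<close> has modulus depending on \<open>a\<close> alone, so only the quotients of
    the linear factors survive.\<close>
  have nn: "norm (Gamma_series (Complex a y) n) =
          Gamma_series a n * (\<Prod>k<Suc n. (a + k) / norm (Complex (a + k) y))"
    if "a > 0" for a :: real and n
  proof -
    have "norm (pochhammer (Complex a y) (Suc n)) = (\<Prod>k<Suc n. norm (Complex (a + k) y))"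
    proof -
      have "Complex a y + of_nat k = Complex (a + k) y" for k
        by (simp add: complex_eq_iff)
      then show ?thesis
        by (simp only: pochhammer_prod atLeast0LessThan flip: prod_norm)
    qed
    moreover have "pochhammer a (Suc n) = (\<Prod>k<Suc n. a + k)"
      by (simp add: pochhammer_prod atLeast0LessThan)
    moreover have "(\<Prod>k<Suc n. a + k) \<noteq> 0" using that
      by (auto simp: prod_zero_iff add_nonneg_eq_0_iff)
    ultimately show ?thesis
      by (simp add: Gamma_series_def norm_divide norm_mult prod_dividef del: prod.lessThan_Suc)
  qed
  have le: "norm (Gamma_series (Complex x y) n) / Gamma_series x n
        \<le> norm (Gamma_series (Complex X y) n) / Gamma_series X n" if "n > 0" for n
  proof -
    have "Gamma_series a n > 0" if "a > 0" for a :: real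
      using that \<open>n > 0\<close> by (auto simp: Gamma_series_def intro!: divide_pos_pos mult_pos_pos pochhammer_pos)
    then have "Gamma_series x n \<noteq> 0" "Gamma_series X n \<noteq> 0" 
      using assms by (metis less_le_trans less_irrefl)+
    moreover have "(\<Prod>k<Suc n. (x + k) / norm (Complex (x + k) y))
        \<le> (\<Prod>k<Suc n. (X + k) / norm (Complex (X + k) y))"
    proof (rule prod_mono, safe)
      fix k :: nat
      define u v where "u = x + k" and "v = X + k"
      have uv: "0 < u" "u \<le> v" using assms by (auto simp: u_def v_def)
      show "0 \<le> (x + k) / norm (Complex (x + k) y)" using assms by simp
      \<comment> \<open>Cross-multiplied form of the monotonicity of
        \<open>u / sqrt (u^2 + y^2)\<close> in \<open>u\<close>.\<close>
      have "u * sqrt (v\<^sup>2 + y\<^sup>2) = sqrt (u\<^sup>2 * v\<^sup>2 + u\<^sup>2 * y\<^sup>2)"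
        using uv by (simp add: real_sqrt_mult flip: distrib_left)
      also have "\<dots> \<le> sqrt (v\<^sup>2 * u\<^sup>2 + v\<^sup>2 * y\<^sup>2)"
        using uv by (simp add: mult_right_mono power_mono)
      also have "\<dots> = v * sqrt (u\<^sup>2 + y\<^sup>2)"
        using uv by (simp add: real_sqrt_mult flip: distrib_left)
      finally show "(x + k) / norm (Complex (x + k) y) \<le> (X + k) / norm (Complex (X + k) y)"
        using uv unfolding u_def[symmetric] v_def[symmetric]
        by (simp add: cmod_def field_simps add_pos_nonneg)
    qed
    ultimately show ?thesis using assms by (simp add: nn)
  qed
  have lim: "(\<lambda>n. norm (Gamma_series (Complex a y) n) / Gamma_series a n)
        \<longlonglongrightarrow> norm (Gamma (Complex a y)) / Gamma a" if "a > 0" for a :: real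
    using Gamma_real_pos[OF that] by (intro tendsto_intros) linarith
  show ?thesis
    by (rule LIMSEQ_le[OF lim lim]) (use assms le in \<open>auto intro!: exI[of _ 1]\<close>)
qed

text \<open>Used to absorb a factor growing linearly in the imaginary part into an arbitrarily small
  change of the exponential rate.\<close>

lemma le_exp_mult:
  fixes e y :: real
  assumes "e > 0"
  shows "y \<le> exp (e * y) / e"
proof -
  have "e * y \<le> exp (e * y)" using exp_ge_add_one_self[of "e * y"] by linarith
  then show ?thesis using assms by (simp add: field_simps)
qed

text \<open>For \<open>z = iy\<close> the values \<open>Gamma (z + 1)\<close> and
  \<open>Gamma (1 - z)\<close> are conjugate, so the reflection formula gives the square of the
  modulus exactly: pi |y| / sinh (pi |y|). The factor |y| uses up the gap \<open>e\<close>, which is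
  pi - 2 \<theta> because the square is estimated.\<close>

lemma norm_Gamma_1_imaginary_le:
  assumes "\<theta> < pi / 2"
  shows "\<exists>C\<ge>0. \<forall>y. 1 \<le> \<bar>y\<bar> \<longrightarrow> norm (Gamma (Complex 1 y)) \<le> C * exp (- \<theta> * \<bar>y\<bar>)"
proof -
  define e where "e = pi - 2 * \<theta>"
  have e: "e > 0" using assms by (simp add: e_def)
  have "norm (Gamma (Complex 1 y)) \<le> sqrt (4 * pi / e) * exp (- \<theta> * \<bar>y\<bar>)" if y: "1 \<le> \<bar>y\<bar>" for y
  proof (rule power2_le_imp_le)
    define z where "z = \<i> * y"
    have z: "z \<notin> \<int>\<^sub>\<le>\<^sub>0" "z \<noteq> 0" using y by (auto simp: z_def complex_is_Int_iff elim!: nonpos_Ints_cases simp: complex_eq_iff)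
    have c: "Complex 1 y = z + 1" "cnj (z + 1) = 1 - z" by (auto simp: z_def complex_eq_iff)
    have nz: "norm z = \<bar>y\<bar>" by (simp add: z_def norm_mult)
    have norm_pi: "norm (complex_of_real pi) = pi" by simp
    have "Gamma (z + 1) * Gamma (1 - z) = z * (of_real pi / sin (of_real pi * z))"
      using z by (simp add: Gamma_plus1 mult.assoc Gamma_reflection_complex)
    moreover have "norm (Gamma (1 - z)) = norm (Gamma (z + 1))"
      by (metis c(2) cnj_Gamma complex_mod_cnj)
    ultimately have sq: "(norm (Gamma (Complex 1 y)))\<^sup>2 = \<bar>y\<bar> * pi / norm (sin (of_real pi * z))"
      unfolding c power2_eq_square
      by (metis norm_mult norm_divide nz norm_pi times_divide_eq_right)
    \<comment> \<open>With \<open>exp (pi * |y|) \<ge> 2\<close> the decaying exponential is at most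
      half of the growing one, which yields the bound by a quarter for the sine.\<close>
    have e1: "exp (pi * \<bar>y\<bar>) \<ge> 2" using exp_ge_add_one_self[of "pi * \<bar>y\<bar>"] y pi_gt3 
        mult_mono[of 1 pi 1 "\<bar>y\<bar>"] by linarith
    have elem: "E / 4 \<le> (E - F) / 2" if "2 \<le> E" "F \<le> 1" for E F :: real
      using that by simp
    have e2: "exp (- (pi * \<bar>y\<bar>)) \<le> 1" by simp
    have "\<bar>exp (- (pi * y)) - exp (pi * y)\<bar> = exp (pi * \<bar>y\<bar>) - exp (- (pi * \<bar>y\<bar>))"
      by (cases "y \<ge> 0") (simp_all add: abs_if zero_less_mult_iff)
    moreover have "norm (sin (of_real pi * z)) = \<bar>exp (- (pi * y)) - exp (pi * y)\<bar> / 2"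
    proof -
      have "\<i> * (of_real pi * z) = of_real (- (pi * y))" by (simp add: z_def complex_eq_iff)
      then have "norm (sin (of_real pi * z))
          = norm (exp (complex_of_real (- (pi * y))) - exp (- complex_of_real (- (pi * y)))) / 2"
        unfolding sin_exp_eq by (simp only: norm_divide norm_mult) simp
      also have "\<dots> = norm (complex_of_real (exp (- (pi * y)) - exp (pi * y))) / 2"
        by (simp add: exp_of_real flip: of_real_mult of_real_minus)
      finally show ?thesis by (simp only: norm_of_real)
    qed
    ultimately have "norm (sin (of_real pi * z)) \<ge> exp (pi * \<bar>y\<bar>) / 4"
      using elem[OF e1 e2] by (simp only:)
    then have "(norm (Gamma (Complex 1 y)))\<^sup>2 \<le> \<bar>y\<bar> * pi / (exp (pi * \<bar>y\<bar>) / 4)"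
      unfolding sq by (intro divide_left_mono mult_pos_pos) (auto intro: less_le_trans[rotated])
    also have "\<dots> = 4 * pi * exp (- pi * \<bar>y\<bar>) * \<bar>y\<bar>" by (simp add: exp_minus field_simps)
    also have "\<dots> \<le> 4 * pi * exp (- pi * \<bar>y\<bar>) * (exp (e * \<bar>y\<bar>) / e)"
      using le_exp_mult[OF e, of "\<bar>y\<bar>"] by (intro mult_left_mono) auto
    also have "\<dots> = 4 * pi / e * exp (- pi * \<bar>y\<bar> + e * \<bar>y\<bar>)"
      by (simp only: exp_add) simp
    also have "\<dots> = 4 * pi / e * (exp (- \<theta> * \<bar>y\<bar>))\<^sup>2"
      by (simp add: e_def algebra_simps flip: exp_double)
    finally show "(norm (Gamma (Complex 1 y)))\<^sup>2 \<le> (sqrt (4 * pi / e) * exp (- \<theta> * \<bar>y\<bar>))\<^sup>2"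
      using e by (simp add: power_mult_distrib)
  qed (use e in auto)
  then show ?thesis using e by (intro exI[of _ "sqrt (4 * pi / e)"]) auto
qed

text \<open>Each application of the functional equation brings in a factor of size O(|y|), paid for
  with half of the remaining gap between \<theta> and pi / 2. The induction therefore runs over all
  \<theta> at once.\<close>

lemma norm_Gamma_Suc_imaginary_le:
  assumes "\<theta> < pi / 2"
  shows "\<exists>C\<ge>0. \<forall>y. 1 \<le> \<bar>y\<bar> \<longrightarrow> norm (Gamma (Complex (1 + real N) y)) \<le> C * exp (- \<theta> * \<bar>y\<bar>)"
  using assms
proof (induction N arbitrary: \<theta>)
  case 0
  then show ?case using norm_Gamma_1_imaginary_le by simp
next
  case (Suc N)
  define e where "e = (pi / 2 - \<theta>) / 2"
  have e: "e > 0" "\<theta> + e < pi / 2" using Suc.prems by (auto simp: e_def field_simps)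
  obtain C where C: "C \<ge> 0"
      "\<And>y. 1 \<le> \<bar>y\<bar> \<Longrightarrow> norm (Gamma (Complex (1 + real N) y)) \<le> C * exp (- (\<theta> + e) * \<bar>y\<bar>)"
    using Suc.IH[OF e(2)] by blast
  have "norm (Gamma (Complex (1 + real (Suc N)) y)) \<le> (2 + real N) / e * C * exp (- \<theta> * \<bar>y\<bar>)"
    if y: "1 \<le> \<bar>y\<bar>" for y
  proof -
    define z where "z = Complex (1 + real N) y"
    have z: "z \<notin> \<int>\<^sub>\<le>\<^sub>0" by (auto simp: z_def complex_eq_iff elim!: nonpos_Ints_cases)
    have "norm z \<le> (1 + real N) + \<bar>y\<bar>" using cmod_le[of z] by (simp add: z_def complex_eq_iff)
    also have "\<dots> \<le> (1 + real N) * \<bar>y\<bar> + \<bar>y\<bar>" using mult_left_mono[OF y, of "1 + real N"] by simp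
    also have "\<dots> = (2 + real N) * \<bar>y\<bar>" by (simp add: algebra_simps)
    also have "\<dots> \<le> (2 + real N) * (exp (e * \<bar>y\<bar>) / e)"
      using le_exp_mult[OF e(1), of "\<bar>y\<bar>"] by (intro mult_left_mono) auto
    finally have nz: "norm z \<le> (2 + real N) * (exp (e * \<bar>y\<bar>) / e)" .
    have "Complex (1 + real (Suc N)) y = z + 1" by (simp add: z_def complex_eq_iff)
    then have "norm (Gamma (Complex (1 + real (Suc N)) y)) = norm z * norm (Gamma z)"
      using z by (simp add: Gamma_plus1 norm_mult)
    also have "\<dots> \<le> (2 + real N) * (exp (e * \<bar>y\<bar>) / e) * (C * exp (- (\<theta> + e) * \<bar>y\<bar>))"
      using nz C y e by (intro mult_mono) (auto simp: z_def)
    also have "\<dots> = (2 + real N) / e * C * exp (e * \<bar>y\<bar> + - (\<theta> + e) * \<bar>y\<bar>)"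
      by (simp only: exp_add) (simp add: field_simps)
    finally show ?thesis by (simp add: algebra_simps)
  qed
  then show ?case using C(1) e(1) by (intro exI[of _ "(2 + real N) / e * C"]) auto
qed

text \<open>Each unit shift multiplies by a number of modulus at least |Im z| \<ge> 1. This carries
  a strip into the half-plane where the Gauss product comparison applies.\<close>

lemma norm_Gamma_le_add_nat:
  assumes "1 \<le> \<bar>Im z\<bar>"
  shows "norm (Gamma z) \<le> norm (Gamma (z + of_nat M))"
proof (induction M)
  case (Suc M)
  have "z + of_nat M \<notin> \<int>\<^sub>\<le>\<^sub>0" using assms by (auto simp: complex_eq_iff elim!: nonpos_Ints_cases)
  then have "norm (Gamma (z + of_nat (Suc M))) = norm (z + of_nat M) * norm (Gamma (z + of_nat M))"
    using Gamma_plus1[of "z + of_nat M"] by (simp add: norm_mult add_ac)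
  moreover have "1 \<le> norm (z + of_nat M)"
    using assms abs_Im_le_cmod[of "z + of_nat M"] by simp
  ultimately show ?case using Suc by (metis mult_right_mono[of 1] norm_ge_zero mult_1 order.trans)
qed simp

text \<open>Shifting by \<open>M\<close> brings the strip to real parts at least 1;
  \<open>norm_Gamma_ratio_mono\<close> then compares with the line of real part \<open>1 + N\<close>
  at its right, and \<open>K\<close> bounds the real values of Gamma in between.\<close>

lemma norm_Gamma_strip_le:
  fixes a b \<theta> :: real
  assumes "\<theta> < pi / 2"
  obtains C where "C \<ge> 0"
    "\<And>z. a \<le> Re z \<Longrightarrow> Re z \<le> b \<Longrightarrow> 1 \<le> \<bar>Im z\<bar> \<Longrightarrow> norm (Gamma z) \<le> C * exp (- \<theta> * \<bar>Im z\<bar>)"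
proof -
  obtain M :: nat where M: "1 - a \<le> real M" using real_arch_simple by blast
  obtain N :: nat where N: "b + real M \<le> real N" using real_arch_simple by blast
  obtain C where C: "C \<ge> 0"
      "\<And>y. 1 \<le> \<bar>y\<bar> \<Longrightarrow> norm (Gamma (Complex (1 + real N) y)) \<le> C * exp (- \<theta> * \<bar>y\<bar>)"
    using norm_Gamma_Suc_imaginary_le[OF assms] by blast
  have "bounded (Gamma ` {1..1 + real N})"
    by (intro compact_imp_bounded compact_continuous_image continuous_on_Gamma)
       (auto elim!: nonpos_Ints_cases)
  then obtain K where "\<forall>x\<in>Gamma ` {1..1 + real N}. norm x \<le> K"
    unfolding bounded_iff by blast
  then have K: "Gamma x \<le> K" if "1 \<le> x" "x \<le> 1 + real N" for x
    using that by (force simp: abs_le_iff)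
  have "norm (Gamma z) \<le> K / Gamma (1 + real N) * C * exp (- \<theta> * \<bar>Im z\<bar>)"
    if z: "a \<le> Re z" "Re z \<le> b" "1 \<le> \<bar>Im z\<bar>" for z
  proof -
    define x where "x = Re z + real M"
    have x: "1 \<le> x" "x \<le> 1 + real N" using z M N by (auto simp: x_def)
    have pos: "Gamma x > 0" "Gamma (1 + real N) > 0" using x by (auto intro!: Gamma_real_pos)
    have "norm (Gamma z) \<le> norm (Gamma (Complex x (Im z)))"
    proof -
      have "z + of_nat M = Complex x (Im z)" by (simp add: x_def complex_eq_iff)
      then show ?thesis using norm_Gamma_le_add_nat[OF z(3), of M] by simp
    qed
    also have "\<dots> \<le> Gamma x * (norm (Gamma (Complex (1 + real N) (Im z))) / Gamma (1 + real N))"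
      using norm_Gamma_ratio_mono[of x "1 + real N" "Im z"] x pos by (simp add: field_simps)
    also have "\<dots> \<le> K * ((C * exp (- \<theta> * \<bar>Im z\<bar>)) / Gamma (1 + real N))"
      using C z x K[OF x] pos order.trans[OF less_imp_le[OF pos(1)] K[OF x]]
      by (intro mult_mono divide_right_mono) auto
    finally show ?thesis by simp
  qed
  moreover have "K \<ge> 0" using K[of 1] by simp
  ultimately show ?thesis using C(1) 
    by (intro that[of "K / Gamma (1 + real N) * C"]) (auto intro!: mult_nonneg_nonneg divide_nonneg_pos Gamma_real_pos)
qed

section \<open>Translating a vertical contour\<close>

lemma valid_path_subpath_UNIV:
  fixes g :: "real \<Rightarrow> complex"
  assumes "g piecewise_C1_differentiable_on UNIV" "u < v"
  shows "valid_path (subpath u v g)"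
proof -
  let ?f = "\<lambda>x. ((v - u) * x + u)"
  have "(g \<circ> ?f) piecewise_C1_differentiable_on {0..1}"
  proof (rule piecewise_C1_differentiable_compose)
    show "?f piecewise_C1_differentiable_on {0..1}"
      by (simp add: C1_differentiable_imp_piecewise)
    show "g piecewise_C1_differentiable_on ?f ` {0..1}"
      using assms piecewise_C1_differentiable_on_subset by blast
    show "\<And>x. finite ({0..1} \<inter> ?f -` {x})"
      using assms by (intro finite_Int disjI2 finite_vimageI) (auto simp: inj_on_def)
  qed
  then show ?thesis by (auto simp: o_def valid_path_def subpath_def)
qed

text \<open>Passes from contour integrals over [0,1] to integrals in the contour's own parameter,
  the form used for improper line integrals. The chain rule may fail only at the finitely many
  breakpoints in \<open>S\<close>.\<close>

lemma has_integral_of_subpath: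
  fixes g :: "real \<Rightarrow> complex"
  assumes g: "g piecewise_C1_differentiable_on UNIV" "u < v"
    and I: "(f has_contour_integral I) (subpath u v g)"
  shows "((\<lambda>t. f (g t) * vector_derivative g (at t)) has_integral I) {u..v}"
proof -
  obtain S where S: "\<And>x. x \<notin> S \<Longrightarrow> g differentiable at x" and fs: "finite S"
    using g unfolding piecewise_C1_differentiable_on_def C1_differentiable_on_eq by blast
  let ?h = "\<lambda>t. f (g t) * vector_derivative g (at t)"
  have vd: "vector_derivative (\<lambda>x. g ((v-u) * x + u)) (at x) = (v-u) *\<^sub>R vector_derivative g (at ((v-u) * x + u))"
    if "x \<notin> (\<lambda>t. (v-u) *\<^sub>R t + u) -` S" for x
  proof (rule vector_derivative_at [OF vector_diff_chain_at [simplified o_def]])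
    show "((\<lambda>x. (v - u) * x + u) has_vector_derivative v - u) (at x)"
      by (intro derivative_eq_intros | simp)+
  qed (use S that in \<open>auto simp: vector_derivative_works\<close>)
  have fin: "finite ((\<lambda>t. (v - u) *\<^sub>R t + u) -` S)"
    using fs g by (auto simp: inj_on_def finite_vimageI)
  have "((\<lambda>x. (v - u) *\<^sub>R ?h ((v - u) * x + u)) has_integral I) {0..1}"
    by (rule has_integral_spike_finite [OF fin _ I[unfolded subpath_def has_contour_integral]])
       (auto simp: vd scaleR_conv_of_real)
  \<comment> \<open>The inverse affine map, with slope \<open>1 / (v - u)\<close>, takes [0,1] back
    to [u,v].\<close>
  then have "((\<lambda>x. (v - u) *\<^sub>R ?h ((v - u) * ((1 / (v - u)) *\<^sub>R x + (- u / (v - u))) + u))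
      has_integral (I /\<^sub>R (1 / (v - u)) ^ DIM(real)))
      (cbox ((0 - (- u / (v - u))) /\<^sub>R (1 / (v - u))) ((1 - (- u / (v - u))) /\<^sub>R (1 / (v - u))))"
    using g by (intro has_integral_affinity') auto
  moreover have "(v - u) * ((1 / (v - u)) *\<^sub>R x + (- u / (v - u))) + u = x" for x
    using g by (simp add: right_diff_distrib)
  moreover have "cbox ((0 - (- u / (v - u))) /\<^sub>R (1 / (v - u))) ((1 - (- u / (v - u))) /\<^sub>R (1 / (v - u)))
      = {u..v}"
    using g by (simp add: field_simps)
  moreover have "I /\<^sub>R (1 / (v - u)) ^ DIM(real) = (v - u) *\<^sub>R I" by simp
  ultimately have "((\<lambda>x. (v - u) *\<^sub>R ?h x) has_integral (v - u) *\<^sub>R I) {u..v}"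
    by (simp only:)
  from has_integral_cmul[OF this, of "1 / (v - u)"] show ?thesis using g by simp
qed

text \<open>Both functions have the same set of derivatives at \<open>t\<close>, so the values agree
  even where that set is empty and \<open>vector_derivative\<close> is a default.\<close>

lemma vector_derivative_add_const:
  fixes g :: "real \<Rightarrow> 'a::real_normed_vector"
  shows "vector_derivative (\<lambda>x. g x + c) (at t) = vector_derivative g (at t)"
proof -
  have "((\<lambda>x. g x + c) has_vector_derivative D) (at t) \<longleftrightarrow> (g has_vector_derivative D) (at t)" for D
    using has_vector_derivative_add_const by (simp add: has_vector_derivative_def has_derivative_add_const)
  then show ?thesis by (simp add: vector_derivative_def)
qed

lemma has_contour_integral_translate_path:
  "(f has_contour_integral I) (\<lambda>s. g s + c) \<longleftrightarrow> ((\<lambda>z. f (z + c)) has_contour_integral I) g"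
  by (simp add: has_contour_integral vector_derivative_add_const)

text \<open>The image is a compact middle piece together with two closed rays. Its closedness makes
  the complement open, so that connected components there are path components.\<close>

lemma vertical_contour_bounds:
  assumes "vertical_contour g"
  obtains R B where "R > 0" "B > 0" "\<And>t. \<bar>t\<bar> \<ge> R \<Longrightarrow> g t = \<i> * of_real t"
    "\<And>t. \<bar>Re (g t)\<bar> \<le> B" "closed (range g)"
proof -
  obtain R0 where R0: "\<And>t. \<bar>t\<bar> \<ge> R0 \<Longrightarrow> g t = \<i> * of_real t"
    using assms unfolding vertical_contour_def by blast
  define R where "R = max R0 1"
  have R: "R > 0" "\<And>t. \<bar>t\<bar> \<ge> R \<Longrightarrow> g t = \<i> * of_real t" by (auto simp: R_def R0)
  have "continuous_on {-R..R} g"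
    using assms unfolding vertical_contour_def piecewise_C1_differentiable_on_def
    by (meson continuous_on_subset subset_UNIV)
  then have cpt: "compact (g ` {-R..R})" by (intro compact_continuous_image) auto
  obtain B where B: "B > 0" "\<And>z. z \<in> g ` {-R..R} \<Longrightarrow> norm z \<le> B"
    using compact_imp_bounded[OF cpt] unfolding bounded_pos by blast
  have Re: "\<bar>Re (g t)\<bar> \<le> B" for t
  proof (cases "\<bar>t\<bar> \<ge> R")
    case True then show ?thesis using R B by simp
  next
    case False
    then have "t \<in> {-R..R}" by auto
    then have "norm (g t) \<le> B" by (intro B) blast
    then show ?thesis using abs_Re_le_cmod[of "g t"] by linarith
  qed
  have "range g = g ` {-R..R} \<union> {z. Re z = 0 \<and> \<bar>Im z\<bar> \<ge> R}"
  proof (intro equalityI subsetI)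
    fix z assume "z \<in> range g"
    then obtain t where "z = g t" by blast
    then show "z \<in> g ` {-R..R} \<union> {z. Re z = 0 \<and> \<bar>Im z\<bar> \<ge> R}"
    proof (cases "\<bar>t\<bar> \<ge> R")
      case True
      then show ?thesis using R(2)[of t] \<open>z = g t\<close> by auto
    next
      case False
      then have "t \<in> {-R..R}" by auto
      then show ?thesis using \<open>z = g t\<close> by blast
    qed
  next
    fix z assume z: "z \<in> g ` {-R..R} \<union> {z. Re z = 0 \<and> \<bar>Im z\<bar> \<ge> R}"
    show "z \<in> range g"
    proof (cases "z \<in> g ` {-R..R}")
      case False
      then have "z = g (Im z)" using z by (simp add: R(2) complex_eq_iff)
      then show ?thesis by (rule range_eqI)
    qed auto
  qed
  moreover have "closed {z. Re z = 0 \<and> \<bar>Im z\<bar> \<ge> R}"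
    by (intro closed_Collect_conj closed_Collect_eq closed_Collect_le continuous_intros)
  ultimately have "closed (range g)" using compact_imp_closed[OF cpt] by (simp add: closed_Un)
  then show ?thesis using that R B Re by blast
qed

text \<open>Closing the truncated contour by the triangle through \<open>- \<sigma> T\<close> gives a loop that does not wind
  around \<open>p\<close>; on the two added sides \<open>Ln (\<sigma> (p - z))\<close> is a primitive of \<open>1 / (z - p)\<close>.\<close>

lemma contour_integral_truncated_inverse:
  fixes \<sigma> :: real
  assumes vc: "vertical_contour g" and \<sigma>: "\<sigma> = 1 \<or> \<sigma> = -1"
    and side: "\<forall>\<^sub>F x in at_top. connected_component (- range g) p (of_real (\<sigma> * x))"
  shows "\<forall>\<^sub>F T in at_top. contour_integral (subpath (-T) T g) (\<lambda>w. 1 / (w - p))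
           = Ln (of_real \<sigma> * (p - \<i> * of_real T)) - Ln (of_real \<sigma> * (p + \<i> * of_real T))"
proof -
  obtain R B where R: "R > 0" "B > 0" "\<And>t. \<bar>t\<bar> \<ge> R \<Longrightarrow> g t = \<i> * of_real t"
    "\<And>t. \<bar>Re (g t)\<bar> \<le> B" "closed (range g)"
    using vertical_contour_bounds[OF vc] by blast
  have pc: "g piecewise_C1_differentiable_on UNIV" using vc by (simp add: vertical_contour_def)
  have "\<forall>\<^sub>F x in at_top. connected_component (- range g) p (of_real (\<sigma> * x)) \<and> x > B"
    using side eventually_gt_at_top by (rule eventually_conj)
  then obtain x where x: "connected_component (- range g) p (of_real (\<sigma> * x))" "x > B"
    using eventually_happens' by force
  have "path_component (- range g) p (of_real (\<sigma> * x))"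
    using x(1) R(5) by (simp add: open_path_connected_component open_Compl)
  then obtain q where q: "path q" "path_image q \<subseteq> - range g" "pathstart q = p"
      "pathfinish q = of_real (\<sigma> * x)"
    unfolding path_component_def by blast
  obtain r where r: "r > 0" "\<And>z. z \<in> path_image q \<Longrightarrow> norm z \<le> r"
    using bounded_path_image[OF q(1)] unfolding bounded_pos by blast
  have pq: "p \<in> path_image q" "of_real (\<sigma> * x) \<in> path_image q"
    using q by (metis pathstart_in_path_image, metis pathfinish_in_path_image)
  have \<sigma>2: "\<sigma> * \<sigma> = 1" "\<sigma> \<noteq> 0" "\<bar>\<sigma>\<bar> = 1" using \<sigma> by auto
  have main: "contour_integral (subpath (-T) T g) (\<lambda>w. 1 / (w - p))
           = Ln (of_real \<sigma> * (p - \<i> * of_real T)) - Ln (of_real \<sigma> * (p + \<i> * of_real T))"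
    \<comment> \<open>\<open>T > R\<close> puts the ends of the truncation on the imaginary axis;
      \<open>T > 2 * r\<close> keeps the two added sides, at distance at least \<open>T / 2\<close>
      from the origin, away from the path \<open>q\<close>.\<close>
    if T: "T > R" "T > 2 * r" for T
  proof -
    define G where "G = subpath (-T) T g"
    define a b d where "a = \<i> * complex_of_real T" and "b = - complex_of_real (\<sigma> * T)" and "d = - \<i> * complex_of_real T"
    define L where "L = G +++ linepath a b +++ linepath b d"
    have T0: "T > 0" using T R by linarith
    have gT: "g T = a" "g (-T) = d" using R(3)[of T] R(3)[of "-T"] T T0 by (auto simp: a_def d_def)
    have vG: "valid_path G" unfolding G_def using pc T0 by (intro valid_path_subpath_UNIV) auto
    have G_ends: "pathstart G = d" "pathfinish G = a"
      by (simp_all add: G_def gT)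
    have imG: "path_image G \<subseteq> range g" by (auto simp: G_def path_image_def subpath_def)
    have vL: "valid_path L" unfolding L_def using vG by (auto simp: G_ends intro!: valid_path_join)
    have loop: "pathfinish L = pathstart L" by (simp add: L_def G_ends)
    have imL: "path_image L = path_image G \<union> closed_segment a b \<union> closed_segment b d"
      unfolding L_def by (auto simp: path_image_join G_ends)
    have far: "T / 2 \<le> norm z" "of_real \<sigma> * (p - z) \<notin> \<real>\<^sub>\<le>\<^sub>0"
      if z: "z \<in> closed_segment a b \<union> closed_segment b d" for z
    proof -
      \<comment> \<open>Here \<open>u\<close> measures the progress towards the vertex
        \<open>b\<close>: on either side |Re z| = u T and |Im z| = (1 - u) T.\<close>
      obtain s u where su: "0 \<le> u" "u \<le> 1" "\<bar>s\<bar> = 1 - u" "Re z = - \<sigma> * (u * T)" "Im z = s * T"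
      proof -
        consider u where "0 \<le> u" "u \<le> 1" "z = (1 - u) *\<^sub>R a + u *\<^sub>R b"
          | u where "0 \<le> u" "u \<le> 1" "z = (1 - u) *\<^sub>R b + u *\<^sub>R d"
          using z by (auto simp: in_segment)
        then show ?thesis
        proof cases
          case 1 then show ?thesis by (intro that[of u "1 - u"]) (auto simp: a_def b_def)
        next
          case 2 then show ?thesis by (intro that[of "1 - u" "- u"]) (auto simp: d_def b_def)
        qed
      qed
      have ab: "\<bar>Re z\<bar> = u * T" "\<bar>Im z\<bar> = (1 - u) * T"
        using su T0 \<sigma>2 by (auto simp: abs_mult)
      have "u \<ge> 1/2 \<or> 1 - u \<ge> 1/2" by linarith
      then have "\<bar>Re z\<bar> \<ge> T / 2 \<or> \<bar>Im z\<bar> \<ge> T / 2"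
        unfolding ab using mult_right_mono[of "1/2" u T] mult_right_mono[of "1/2" "1 - u" T] T0 by auto
      then show "T / 2 \<le> norm z"
        using abs_Re_le_cmod[of z] abs_Im_le_cmod[of z] by linarith
      have pb: "\<bar>Re p\<bar> < T / 2" "\<bar>Im p\<bar> < T / 2"
        using r(2)[OF pq(1)] T abs_Re_le_cmod[of p] abs_Im_le_cmod[of p] by linarith+
      \<comment> \<open>On the branch cut both \<open>u T\<close> and \<open>(1 - u) T\<close> would
        be bounded by a coordinate of \<open>p\<close>, hence be below \<open>T / 2\<close>,
        although they add up to \<open>T\<close>.\<close>
      show "of_real \<sigma> * (p - z) \<notin> \<real>\<^sub>\<le>\<^sub>0"
      proof
        assume "of_real \<sigma> * (p - z) \<in> \<real>\<^sub>\<le>\<^sub>0"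
        then have "\<sigma> * (Re p - Re z) \<le> 0" "Im p = Im z"
          using \<sigma>2 by (auto simp: complex_nonpos_Reals_iff)
        moreover have "\<sigma> * (Re p - Re z) = \<sigma> * Re p + u * T"
          unfolding su(4) using \<sigma>2(1) by (simp add: algebra_simps)
        moreover have "\<bar>\<sigma> * Re p\<bar> = \<bar>Re p\<bar>" using \<sigma>2 by (simp add: abs_mult)
        ultimately have "u * T < T / 2" "(1 - u) * T < T / 2"
          using pb ab by linarith+
        then show False by (simp add: algebra_simps)
      qed
    qed
    have disj: "path_image q \<inter> path_image L = {}"
    proof -
      have "z \<notin> path_image q" if "z \<in> closed_segment a b \<union> closed_segment b d" for z
        using far(1)[OF that] r(2)[of z] T by auto
      then show ?thesis unfolding imL using q(2) imG by blast
    qed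
    \<comment> \<open>The winding number is constant along \<open>q\<close>, and the endpoint of
      \<open>q\<close> lies outside a half-plane that contains the whole loop, since the triangle
      was closed on the opposite side.\<close>
    have "winding_number L p = winding_number L (of_real (\<sigma> * x))"
      by (rule winding_number_eq[where S = "path_image q"])
         (use vL loop pq disj q(1) in \<open>auto intro: valid_path_imp_path connected_path_image\<close>)
    also have "\<dots> = 0"
    proof (rule winding_number_zero_outside[where s = "{z. \<sigma> * Re z \<le> B}"])
      show cvx: "convex {z. \<sigma> * Re z \<le> B}"
        using convex_halfspace_le[of "of_real \<sigma> :: complex" B] by (simp add: inner_complex_def)
      show "complex_of_real (\<sigma> * x) \<notin> {z. \<sigma> * Re z \<le> B}"
        using x(2) \<sigma>2 by (simp flip: mult.assoc)
      have "\<sigma> * Re w \<le> \<bar>Re w\<bar>" for w using \<sigma> by auto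
      then have "range g \<subseteq> {z. \<sigma> * Re z \<le> B}" using R(4) by (auto intro: order.trans)
      moreover have "a \<in> {z. \<sigma> * Re z \<le> B}" "b \<in> {z. \<sigma> * Re z \<le> B}" "d \<in> {z. \<sigma> * Re z \<le> B}"
        using R T0 \<sigma> by (auto simp: a_def b_def d_def)
      ultimately show "path_image L \<subseteq> {z. \<sigma> * Re z \<le> B}"
        unfolding imL using imG closed_segment_subset[OF _ _ cvx] by blast
    qed (use vL loop in \<open>auto intro: valid_path_imp_path\<close>)
    finally have "winding_number L p = 0" .
    moreover have pL: "p \<notin> path_image L" using disj pq by blast
    ultimately have "contour_integral L (\<lambda>w. 1 / (w - p)) = 0"
      using winding_number_valid_path[OF vL pL] by simp
    moreover have "(\<lambda>w. 1 / (w - p)) contour_integrable_on h"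
      if "valid_path h" "path_image h \<subseteq> path_image L" for h
      using that pL by (intro contour_integrable_inversediff) auto
    moreover have prim: "((\<lambda>w. 1 / (w - p)) has_contour_integral
         (Ln (of_real \<sigma> * (p - pathfinish h)) - Ln (of_real \<sigma> * (p - pathstart h)))) h"
      if "valid_path h" "path_image h \<subseteq> closed_segment a b \<union> closed_segment b d" for h
    proof (rule contour_integral_primitive[OF _ that])
      fix z assume z: "z \<in> closed_segment a b \<union> closed_segment b d"
      have "z \<noteq> p" using far(2)[OF z] by auto
      then show "((\<lambda>z. Ln (of_real \<sigma> * (p - z))) has_field_derivative 1 / (z - p))
           (at z within closed_segment a b \<union> closed_segment b d)"
        using far(2)[OF z] \<sigma>2 by (auto intro!: derivative_eq_intros simp: divide_simps)
    qed
    ultimately have "contour_integral G (\<lambda>w. 1 / (w - p))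
        + (Ln (of_real \<sigma> * (p - b)) - Ln (of_real \<sigma> * (p - a)))
        + (Ln (of_real \<sigma> * (p - d)) - Ln (of_real \<sigma> * (p - b))) = 0"
      using contour_integral_unique[OF prim[of "linepath a b"]] contour_integral_unique[OF prim[of "linepath b d"]]
      by (simp add: L_def vG imL path_image_join G_ends contour_integrable_join le_supI2)
    then show ?thesis unfolding G_def[symmetric] by (simp add: a_def d_def algebra_simps)
  qed
  have "\<forall>\<^sub>F T in at_top. T > R \<and> T > 2 * r"
    by (intro eventually_conj eventually_gt_at_top)
  then show ?thesis by eventually_elim (use main in blast)
qed

section \<open>The loop between a contour and its translate\<close>

text \<open>The boundary of the region between the contour and its translate by 1, cut off at
  heights \<open>T\<close> and \<open>-T\<close>; it may intersect itself.\<close>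

definition translation_loop :: "(real \<Rightarrow> complex) \<Rightarrow> real \<Rightarrow> real \<Rightarrow> complex" where
  "translation_loop g T = subpath (-T) T g +++ linepath (\<i> * of_real T) (1 + \<i> * of_real T)
     +++ reversepath (\<lambda>s. subpath (-T) T g s + 1)
     +++ linepath (1 - \<i> * of_real T) (- \<i> * of_real T)"

lemma translation_loop:
  fixes T :: real
  assumes pc: "g piecewise_C1_differentiable_on UNIV" and T: "T > 0"
    and gT: "g T = \<i> * of_real T" "g (-T) = - \<i> * of_real T"
  shows "valid_path (translation_loop g T)"
    and "pathfinish (translation_loop g T) = pathstart (translation_loop g T)"
    and "path_image (translation_loop g T) \<subseteq> range g \<union> (\<lambda>z. z + 1) ` range g
           \<union> {z. 0 \<le> Re z \<and> Re z \<le> 1 \<and> \<bar>Im z\<bar> = T}"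
    and "\<lbrakk>open U; f holomorphic_on U; path_image (translation_loop g T) \<subseteq> U\<rbrakk> \<Longrightarrow>
      contour_integral (translation_loop g T) f
        = contour_integral (subpath (-T) T g) f
        + contour_integral (linepath (\<i> * of_real T) (1 + \<i> * of_real T)) f
        - contour_integral (subpath (-T) T g) (\<lambda>z. f (z + 1))
        + contour_integral (linepath (1 - \<i> * of_real T) (- \<i> * of_real T)) f
      \<and> f contour_integrable_on (subpath (-T) T g)
      \<and> (\<lambda>z. f (z + 1)) contour_integrable_on (subpath (-T) T g)
      \<and> f contour_integrable_on linepath (\<i> * of_real T) (1 + \<i> * of_real T)
      \<and> f contour_integrable_on linepath (1 - \<i> * of_real T) (- \<i> * of_real T)"
proof -
  define G where "G = subpath (-T) T g"
  define H where "H = (\<lambda>s. subpath (-T) T g s + 1)"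
  define a b where "a = linepath (\<i> * complex_of_real T) (1 + \<i> * of_real T)"
    and "b = linepath (1 - \<i> * complex_of_real T) (- \<i> * of_real T)"
  have L: "translation_loop g T = G +++ a +++ reversepath H +++ b"
    by (simp add: translation_loop_def G_def H_def a_def b_def)
  have vG: "valid_path G" unfolding G_def using pc T by (intro valid_path_subpath_UNIV) auto
  have "valid_path ((\<lambda>z. z + 1) \<circ> G)"
    using vG by (intro valid_path_compose_holomorphic[where S = UNIV]) (auto intro!: holomorphic_intros)
  then have vH: "valid_path H" by (simp add: H_def G_def o_def)
  have v: "valid_path a" "valid_path b" "valid_path (reversepath H)"
    using vH by (auto simp: a_def b_def)
  have ends: "pathstart G = - \<i> * of_real T" "pathfinish G = \<i> * of_real T"
     "pathstart H = 1 - \<i> * of_real T" "pathfinish H = 1 + \<i> * of_real T"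
    "pathstart a = \<i> * of_real T" "pathfinish a = 1 + \<i> * of_real T"
    "pathstart b = 1 - \<i> * of_real T" "pathfinish b = - \<i> * of_real T"
    using gT by (auto simp: G_def H_def a_def b_def pathstart_def pathfinish_def subpath_def linepath_def)
  show "valid_path (translation_loop g T)"
    unfolding L using vG v ends by (auto intro!: valid_path_join)
  show "pathfinish (translation_loop g T) = pathstart (translation_loop g T)"
    unfolding L using ends by simp
  have im: "path_image (translation_loop g T) = path_image G \<union> path_image a \<union> path_image H \<union> path_image b"
    unfolding L using ends by (auto simp: path_image_join)
  have "path_image G \<subseteq> range g" "path_image H \<subseteq> (\<lambda>z. z + 1) ` range g"
    by (auto simp: G_def H_def path_image_def subpath_def)
  moreover have "path_image a \<subseteq> {z. 0 \<le> Re z \<and> Re z \<le> 1 \<and> \<bar>Im z\<bar> = T}"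
      "path_image b \<subseteq> {z. 0 \<le> Re z \<and> Re z \<le> 1 \<and> \<bar>Im z\<bar> = T}"
    using T by (auto simp: a_def b_def closed_segment_same_Im closed_segment_eq_real_ivl)
  ultimately show "path_image (translation_loop g T) \<subseteq> range g \<union> (\<lambda>z. z + 1) ` range g
           \<union> {z. 0 \<le> Re z \<and> Re z \<le> 1 \<and> \<bar>Im z\<bar> = T}"
    unfolding im by blast
  assume f: "open U" "f holomorphic_on U" "path_image (translation_loop g T) \<subseteq> U"
  have int: "f contour_integrable_on h" if "valid_path h" "path_image h \<subseteq> path_image (translation_loop g T)" for h
    using f that by (intro contour_integrable_holomorphic_simple[of f U]) auto
  have ints: "f contour_integrable_on G" "f contour_integrable_on a" "f contour_integrable_on H"
     "f contour_integrable_on b"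
    by (rule int; use vG vH v im in auto)+
  have H: "(f has_contour_integral I) H \<longleftrightarrow> ((\<lambda>z. f (z + 1)) has_contour_integral I) G" for I
    unfolding H_def G_def by (rule has_contour_integral_translate_path)
  then have "contour_integral H f = contour_integral G (\<lambda>z. f (z + 1))"
      "(\<lambda>z. f (z + 1)) contour_integrable_on G"
    using ints(3) by (auto simp: contour_integrable_on_def contour_integral_unique)
  moreover have "contour_integral (translation_loop g T) f = contour_integral G f + contour_integral a f
     - contour_integral H f + contour_integral b f"
    unfolding L using ints vG vH v ends 
    by (simp add: contour_integrable_join contour_integrable_reversepath contour_integral_reversepath
          valid_path_join)
  ultimately show "contour_integral (translation_loop g T) f
        = contour_integral (subpath (-T) T g) f
        + contour_integral (linepath (\<i> * of_real T) (1 + \<i> * of_real T)) f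
        - contour_integral (subpath (-T) T g) (\<lambda>z. f (z + 1))
        + contour_integral (linepath (1 - \<i> * of_real T) (- \<i> * of_real T)) f
      \<and> f contour_integrable_on (subpath (-T) T g)
      \<and> (\<lambda>z. f (z + 1)) contour_integrable_on (subpath (-T) T g)
      \<and> f contour_integrable_on linepath (\<i> * of_real T) (1 + \<i> * of_real T)
      \<and> f contour_integrable_on linepath (1 - \<i> * of_real T) (- \<i> * of_real T)"
    using ints by (simp add: G_def a_def b_def)
qed

text \<open>The translated side contributes the integral for \<open>p - 1\<close> along the original
  contour. If \<open>p\<close> and \<open>p - 1\<close> lie on the same side, all four sides are
  evaluated with the same logarithm \<open>Ln (\<sigma> (p - z))\<close>, and the values at the
  corners telescope to 0.\<close>

lemma winding_number_translation_loop:
  fixes \<sigma> :: real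
  assumes vc: "vertical_contour g" and \<sigma>: "\<sigma> = 1 \<or> \<sigma> = -1"
    and side: "\<forall>\<^sub>F x in at_top. connected_component (- range g) p (of_real (\<sigma> * x))"
    and side': "\<forall>\<^sub>F x in at_top. connected_component (- range g) (p - 1) (of_real (\<sigma> * x))"
  shows "\<forall>\<^sub>F T in at_top. winding_number (translation_loop g T) p = 0"
proof -
  obtain R B where R: "R > 0" "B > 0" "\<And>t. \<bar>t\<bar> \<ge> R \<Longrightarrow> g t = \<i> * of_real t"
    "\<And>t. \<bar>Re (g t)\<bar> \<le> B" "closed (range g)"
    using vertical_contour_bounds[OF vc] by blast
  have pc: "g piecewise_C1_differentiable_on UNIV" using vc by (simp add: vertical_contour_def)
  have notin: "p \<notin> range g" "p - 1 \<notin> range g"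
    using eventually_happens'[OF _ side] eventually_happens'[OF _ side'] connected_component_in by force+
  have "\<forall>\<^sub>F T in at_top. T > R \<and> T > \<bar>Im p\<bar>"
    by (intro eventually_conj eventually_gt_at_top)
  then show ?thesis
    using contour_integral_truncated_inverse[OF vc \<sigma> side] contour_integral_truncated_inverse[OF vc \<sigma> side']
  proof eventually_elim
    case (elim T)
    have T0: "T > 0" using elim R by linarith
    have gT: "g T = \<i> * of_real T" "g (-T) = - \<i> * of_real T"
      using R(3)[of T] R(3)[of "-T"] elim T0 by auto
    note TL = translation_loop[OF pc T0 gT]
    have pL: "p \<notin> path_image (translation_loop g T)"
    proof
      assume "p \<in> path_image (translation_loop g T)"
      then have "p \<in> range g \<union> (\<lambda>z. z + 1) ` range g \<union> {z. 0 \<le> Re z \<and> Re z \<le> 1 \<and> \<bar>Im z\<bar> = T}"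
        using TL(3) by blast
      then show False using notin elim by (auto simp: diff_eq_eq)
    qed
    \<comment> \<open>Since \<open>T > |Im p|\<close>, the difference \<open>p - z\<close> is never
      real on a horizontal side, which keeps it off the branch cut.\<close>
    have prim: "contour_integral (linepath u v) (\<lambda>w. 1 / (w - p)) =
         Ln (of_real \<sigma> * (p - v)) - Ln (of_real \<sigma> * (p - u))" if uv: "Im u = Im v" "\<bar>Im v\<bar> = T" for u v
    proof -
      have Im: "Im z = Im v" if "z \<in> closed_segment u v" for z
        using that uv by (simp add: closed_segment_same_Im)
      have "((\<lambda>w. 1 / (w - p)) has_contour_integral
         (Ln (of_real \<sigma> * (p - pathfinish (linepath u v))) - Ln (of_real \<sigma> * (p - pathstart (linepath u v)))))
           (linepath u v)"
      proof (rule contour_integral_primitive)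
        show "path_image (linepath u v) \<subseteq> closed_segment u v" by simp
        fix z assume z: "z \<in> closed_segment u v"
        have "Im (of_real \<sigma> * (p - z)) \<noteq> 0" using Im[OF z] uv elim \<sigma> by auto
        then have "of_real \<sigma> * (p - z) \<notin> \<real>\<^sub>\<le>\<^sub>0" "z \<noteq> p" by (auto simp: complex_nonpos_Reals_iff)
        then show "((\<lambda>z. Ln (of_real \<sigma> * (p - z))) has_field_derivative 1 / (z - p))
             (at z within closed_segment u v)"
          using \<sigma> by (auto intro!: derivative_eq_intros simp: divide_simps)
      qed auto
      then show ?thesis by (simp add: contour_integral_unique)
    qed
    have shift: "(\<lambda>z. 1 / (z + 1 - p)) = (\<lambda>z. 1 / (z - (p - 1)))" by (auto simp: algebra_simps)
    have hol: "(\<lambda>w. 1 / (w - p)) holomorphic_on - {p}" by (auto intro!: holomorphic_intros)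
    have t1: "contour_integral (linepath (\<i> * of_real T) (1 + \<i> * of_real T)) (\<lambda>w. 1 / (w - p))
        = Ln (of_real \<sigma> * (p - 1 - \<i> * of_real T)) - Ln (of_real \<sigma> * (p - \<i> * of_real T))"
      using T0 by (subst prim) (simp_all add: diff_diff_eq)
    have t2: "contour_integral (linepath (1 - \<i> * of_real T) (- \<i> * of_real T)) (\<lambda>w. 1 / (w - p))
        = Ln (of_real \<sigma> * (p + \<i> * of_real T)) - Ln (of_real \<sigma> * (p - 1 + \<i> * of_real T))"
      using T0 by (subst prim) (simp_all add: diff_diff_eq2 add_diff_eq diff_add_eq)
    have "path_image (translation_loop g T) \<subseteq> - {p}" using pL by blast
    from TL(4)[OF open_delete[OF open_UNIV, folded Compl_eq_Diff_UNIV] hol this] have "contour_integral (translation_loop g T) (\<lambda>w. 1 / (w - p)) = 0"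
      unfolding shift elim(2) elim(3) t1 t2 by simp
    then show ?case using winding_number_valid_path[OF TL(1) pL] by simp
  qed
qed

text \<open>Puts the left side into the form with \<sigma> = -1 used by the winding number
  lemmas.\<close>

lemma left_of_contour_iff:
  "left_of_contour g p \<longleftrightarrow> (\<forall>\<^sub>F x in at_top. connected_component (- range g) p (of_real (- 1 * x)))"
  unfolding left_of_contour_def at_bot_mirror by (simp add: eventually_filtermap)

lemma contour_avoids:
  assumes "right_of_contour g p \<or> left_of_contour g p"
  shows "p \<notin> range g"
proof -
  have "\<exists>q. connected_component (- range g) p q"
    using assms unfolding right_of_contour_def left_of_contour_def
    by (auto dest!: eventually_happens)
  then show ?thesis using connected_component_in by fastforce
qed

text \<open>Cauchy's theorem on the translation loop leaves only the two horizontal sides, of length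
  1, where \<open>h\<close> tends to 0. Points outside \<open>U\<close> have winding number 0: far
  ones because the loop lies in a convex strip, the others because they do not separate the contour
  from its translate.\<close>

lemma contour_integral_translate_tendsto:
  assumes vc: "vertical_contour g" and U: "open U" "h holomorphic_on U"
    and fin: "\<And>K. finite {p \<in> - U. \<bar>Re p\<bar> \<le> K}"
    and side: "\<And>p. p \<notin> U \<Longrightarrow> (right_of_contour g p \<and> right_of_contour g (p - 1))
                              \<or> (left_of_contour g p \<and> left_of_contour g (p - 1))"
    and decay: "\<And>e. e > 0 \<Longrightarrow> \<forall>\<^sub>F T in at_top. \<forall>z. 0 \<le> Re z \<longrightarrow> Re z \<le> 1 \<longrightarrow> \<bar>Im z\<bar> = T \<longrightarrow> norm (h z) \<le> e"
  shows "((\<lambda>T. contour_integral (subpath (-T) T g) h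
             - contour_integral (subpath (-T) T g) (\<lambda>z. h (z + 1))) \<longlongrightarrow> 0) at_top"
proof -
  obtain R B where R: "R > 0" "B > 0" "\<And>t. \<bar>t\<bar> \<ge> R \<Longrightarrow> g t = \<i> * of_real t"
    "\<And>t. \<bar>Re (g t)\<bar> \<le> B" "closed (range g)"
    using vertical_contour_bounds[OF vc] by blast
  have pc: "g piecewise_C1_differentiable_on UNIV" using vc by (simp add: vertical_contour_def)
  have wn_single: "\<forall>\<^sub>F T in at_top. winding_number (translation_loop g T) p = 0" if "p \<notin> U" for p
    using side[OF that] winding_number_translation_loop[OF vc, of 1 p]
      winding_number_translation_loop[OF vc, of "-1" p]
    by (auto simp: right_of_contour_def left_of_contour_iff)
  \<comment> \<open>Only finitely many bad points lie in the strip, so one threshold for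
    \<open>T\<close> serves all of them.\<close>
  have ev: "\<forall>\<^sub>F T in at_top. (\<forall>p\<in>{p \<in> - U. \<bar>Re p\<bar> \<le> B + 1}.
      winding_number (translation_loop g T) p = 0 \<and> \<bar>Im p\<bar> < T) \<and> T > R"
    using fin[of "B + 1"] wn_single
    by (intro eventually_conj eventually_ball_finite ballI eventually_gt_at_top) auto
  show ?thesis
  proof (rule tendstoI)
    fix e :: real assume e: "e > 0"
    have "\<forall>\<^sub>F T in at_top. \<forall>z. 0 \<le> Re z \<longrightarrow> Re z \<le> 1 \<longrightarrow> \<bar>Im z\<bar> = T \<longrightarrow> norm (h z) \<le> e / 3"
      using e by (intro decay) auto
    then show "\<forall>\<^sub>F T in at_top. dist (contour_integral (subpath (-T) T g) h
             - contour_integral (subpath (-T) T g) (\<lambda>z. h (z + 1))) 0 < e"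
      using ev
    proof eventually_elim
      case (elim T)
      define L where "L = translation_loop g T"
      define a b where "a = linepath (\<i> * complex_of_real T) (1 + \<i> * of_real T)"
        and "b = linepath (1 - \<i> * complex_of_real T) (- \<i> * of_real T)"
      have T0: "T > 0" using elim R by linarith
      have gT: "g T = \<i> * of_real T" "g (-T) = - \<i> * of_real T"
        using R(3)[of T] R(3)[of "-T"] elim T0 by auto
      note TL = translation_loop[OF pc T0 gT, folded L_def a_def b_def]
      have LU: "path_image L \<subseteq> U"
      \<comment> \<open>A bad point avoids the contour and its translate, so it could only lie on a
        horizontal side; \<open>T > |Im p|\<close> excludes this.\<close>
      proof (rule subsetI, rule ccontr)
        fix p assume p: "p \<in> path_image L" "p \<notin> U"
        then have "p \<notin> range g" "p - 1 \<notin> range g"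
          using side contour_avoids by blast+
        moreover have "p \<in> range g \<union> (\<lambda>z. z + 1) ` range g \<union> {z. 0 \<le> Re z \<and> Re z \<le> 1 \<and> \<bar>Im z\<bar> = T}"
          using p(1) TL(3) by blast
        ultimately have "0 \<le> Re p" "Re p \<le> 1" "\<bar>Im p\<bar> = T" by auto
        then show False using elim(2) p(2) R(2) by auto
      qed
      have "(h has_contour_integral 0) L"
      proof (rule Cauchy_theorem_global[OF U TL(1,2) LU])
        fix p assume p: "p \<notin> U"
        show "winding_number L p = 0"
        proof (cases "\<bar>Re p\<bar> \<le> B + 1")
          case True
          then show ?thesis using elim(2) p by (auto simp: L_def)
        next
          case False
          have "{z. \<bar>Re z\<bar> \<le> B + 1} = {z. Re z \<le> B + 1} \<inter> {z. Re z \<ge> - (B + 1)}" by auto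
          then have "convex {z. \<bar>Re z\<bar> \<le> B + 1}"
            by (simp add: convex_Int convex_halfspace_Re_le convex_halfspace_Re_ge)
          moreover have "range g \<union> (\<lambda>z. z + 1) ` range g \<union> {z. 0 \<le> Re z \<and> Re z \<le> 1 \<and> \<bar>Im z\<bar> = T}
              \<subseteq> {z. \<bar>Re z\<bar> \<le> B + 1}"
          proof -
            have "\<bar>Re (g t)\<bar> \<le> B + 1" "\<bar>Re (g t) + 1\<bar> \<le> B + 1" for t
              using R(4)[of t] by linarith+
            then show ?thesis using R(2) by auto
          qed
          with TL(3) have "path_image L \<subseteq> {z. \<bar>Re z\<bar> \<le> B + 1}" by (rule order.trans)
          ultimately show ?thesis
            using TL(1,2) False
            by (intro winding_number_zero_outside[where s = "{z. \<bar>Re z\<bar> \<le> B + 1}"])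
               (auto intro: valid_path_imp_path)
        qed
      qed
      then have L0: "contour_integral L h = 0" by (rule contour_integral_unique)
      note TL4 = TL(4)[OF U LU]
      have "norm (contour_integral a h) \<le> e / 3 * norm ((1 + \<i> * of_real T) - \<i> * of_real T)"
        unfolding a_def using TL4[unfolded a_def] e elim(1) T0
        by (intro contour_integral_bound_linepath)
           (auto simp: closed_segment_same_Im closed_segment_eq_real_ivl)
      moreover have "norm (contour_integral b h) \<le> e / 3 * norm ((- \<i> * of_real T) - (1 - \<i> * of_real T))"
        unfolding b_def using TL4[unfolded b_def] e elim(1) T0
        by (intro contour_integral_bound_linepath)
           (auto simp: closed_segment_same_Im closed_segment_eq_real_ivl)
      moreover have "contour_integral (subpath (-T) T g) h
             - contour_integral (subpath (-T) T g) (\<lambda>z. h (z + 1))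
           = - contour_integral a h - contour_integral b h"
        using TL4 L0 by (simp add: algebra_simps)
      moreover have "norm (- contour_integral a h - contour_integral b h)
          \<le> norm (contour_integral a h) + norm (contour_integral b h)"
        using norm_triangle_ineq4[of "- contour_integral a h" "contour_integral b h"] by simp
      ultimately show ?case using e by (simp add: dist_norm)
    qed
  qed
qed

section \<open>Improper integrals along a vertical contour\<close>

lemma integral_symmetric_tendsto:
  fixes f :: "real \<Rightarrow> complex"
  assumes "f integrable_on UNIV"
  shows "((\<lambda>T. integral {-T..T} f) \<longlongrightarrow> integral UNIV f) at_top"
proof (rule tendstoI)
  fix e :: real assume "e > 0"
  moreover have "(f has_integral integral UNIV f) UNIV" using assms by (rule integrable_integral)
  ultimately obtain B where B: "B > 0"
      "\<And>a b. ball 0 B \<subseteq> cbox a b \<Longrightarrow> norm (integral (cbox a b) f - integral UNIV f) < e"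
    unfolding has_integral_alt' by force
  have "dist (integral {-T..T} f) (integral UNIV f) < e" if "T > B" for T
    using B(2)[of "-T" T] that by (force simp: dist_norm)
  then show "\<forall>\<^sub>F T in at_top. dist (integral {-T..T} f) (integral UNIV f) < e"
    using eventually_gt_at_top[of B] by (rule eventually_mono[rotated])
qed

lemma integrable_on_exp_tails:
  fixes R d :: real
  assumes "d > 0" and that: "R \<ge> 0"
  shows "(\<lambda>t. exp (- d * \<bar>t\<bar>)) integrable_on {R..}" "(\<lambda>t. exp (- d * \<bar>t\<bar>)) integrable_on {..-R}"
proof -
  have *: "(\<lambda>t. exp (- d * t)) integrable_on {R..}"
    by (rule integrable_on_exp_minus_to_infinity[OF assms(1)])
  then show "(\<lambda>t. exp (- d * \<bar>t\<bar>)) integrable_on {R..}"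
    by (rule integrable_eq) (use that in auto)
  have "(\<lambda>t. exp (- d * t)) absolutely_integrable_on {R..}"
    using * by (intro nonnegative_absolutely_integrable_1) auto
  then have "(\<lambda>t. exp (- d * - t)) absolutely_integrable_on {..-R}"
    using has_absolute_integral_reflect_real[of "{..-R}" "{R..}" "\<lambda>t. exp (- d * t)"] by auto
  then have "(\<lambda>t. exp (- d * - t)) integrable_on {..-R}"
    by (rule set_lebesgue_integral_eq_integral)
  then show "(\<lambda>t. exp (- d * \<bar>t\<bar>)) integrable_on {..-R}"
    by (rule integrable_eq) (use that in auto)
qed

lemma has_integral_truncated_contour:
  assumes vc: "vertical_contour g" and U: "open U" "f holomorphic_on U" "range g \<subseteq> U" and "u < v"
  shows "((\<lambda>t. f (g t) * vector_derivative g (at t)) has_integral contour_integral (subpath u v g) f) {u..v}"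
proof -
  have pc: "g piecewise_C1_differentiable_on UNIV" using vc by (simp add: vertical_contour_def)
  have "path_image (subpath u v g) \<subseteq> U" using U(3) by (auto simp: path_image_def subpath_def)
  then have "f contour_integrable_on (subpath u v g)"
    using U valid_path_subpath_UNIV[OF pc \<open>u < v\<close>]
    by (intro contour_integrable_holomorphic_simple[of f U]) auto
  then show ?thesis
    by (intro has_integral_of_subpath[OF pc \<open>u < v\<close>] has_contour_integral_integral)
qed

lemma line_contour_integrable:
  assumes vc: "vertical_contour g" and U: "open U" "f holomorphic_on U" "range g \<subseteq> U"
    and d: "d > 0" and bound: "\<And>t. \<bar>t\<bar> \<ge> T0 \<Longrightarrow> norm (f (\<i> * of_real t)) \<le> C * exp (- d * \<bar>t\<bar>)"
  shows "(\<lambda>t. f (g t) * vector_derivative g (at t)) integrable_on UNIV"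
proof -
  obtain R B where R: "R > 0" "B > 0" "\<And>t. \<bar>t\<bar> \<ge> R \<Longrightarrow> g t = \<i> * of_real t"
    "\<And>t. \<bar>Re (g t)\<bar> \<le> B" "closed (range g)"
    using vertical_contour_bounds[OF vc] by blast
  \<comment> \<open>Strictly beyond \<open>R\<close>, so that the contour agrees with the imaginary
    axis on a neighbourhood of every \<open>t\<close> with |t| \<ge> Q and its derivative there is
    \<open>\<i>\<close>.\<close>
  define Q where "Q = max (R + 1) T0"
  have Q: "Q > R" "Q \<ge> T0" "Q > 0" using R by (auto simp: Q_def)
  let ?F = "\<lambda>t. f (g t) * vector_derivative g (at t)"
  have fin: "?F integrable_on {a..b}" for a b
  proof (rule integrable_on_subinterval)
    \<comment> \<open>The enlarged interval is nondegenerate, as the truncation lemma requires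
      \<open>u < v\<close>.\<close>
    show "?F integrable_on {a..max (a + 1) b}"
      by (rule has_integral_integrable[OF has_integral_truncated_contour[OF vc U]]) simp
  qed auto
  have vd: "vector_derivative g (at t) = \<i>" if "\<bar>t\<bar> \<ge> Q" for t
  proof (rule vector_derivative_at)
    have "((\<lambda>t. \<i> * of_real t) has_vector_derivative \<i>) (at t)"
      by (auto intro!: derivative_eq_intros)
    then show "(g has_vector_derivative \<i>) (at t)"
    proof (rule has_vector_derivative_transform_within_open)
      show "open {x. \<bar>x\<bar> > R}" by (intro open_Collect_less continuous_intros)
    qed (use that Q R in auto)
  qed
  have bnd: "norm (?F t) \<le> C * exp (- d * \<bar>t\<bar>)" if "\<bar>t\<bar> \<ge> Q" for t
    using that vd[OF that] bound[of t] R(3)[of t] Q by (simp add: norm_mult)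
  have tail: "?F integrable_on S" if S: "S = {Q..} \<or> S = {..-Q}" for S
  proof (rule integrable_on_all_intervals_integrable_bound)
    show "(\<lambda>t. if t \<in> S then ?F t else 0) integrable_on cbox a b" for a b
    proof -
      have "S \<inter> {a..b} = {max a Q..b} \<or> S \<inter> {a..b} = {a..min b (-Q)}" using S by auto
      then have "?F integrable_on S \<inter> {a..b}" using fin by auto
      then show ?thesis by (simp add: integrable_restrict_Int)
    qed
    show "norm (?F t) \<le> C * exp (- d * \<bar>t\<bar>)" if "t \<in> S" for t
      using that S Q by (intro bnd) auto
    have "(\<lambda>t. exp (- d * \<bar>t\<bar>)) integrable_on S"
      using S integrable_on_exp_tails[OF d, of Q] Q by auto
    then show "(\<lambda>t. C * exp (- d * \<bar>t\<bar>)) integrable_on S"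
      by (rule integrable_on_mult_right)
  qed
  have "?F integrable_on ({..-Q} \<union> {-Q..Q} \<union> {Q..})"
  proof (intro integrable_Un)
    have "{..-Q} \<inter> {-Q..Q} \<subseteq> {-Q}" "({..-Q} \<union> {-Q..Q}) \<inter> {Q..} \<subseteq> {Q}" using Q by auto
    then show "negligible ({..-Q} \<inter> {-Q..Q})" "negligible (({..-Q} \<union> {-Q..Q}) \<inter> {Q..})"
      by (auto intro: negligible_subset negligible_sing)
  qed (use tail fin in auto)
  moreover have "{..-Q} \<union> {-Q..Q} \<union> {Q..} = UNIV" by auto
  ultimately show ?thesis by simp
qed

text \<open>Moving the contour by one is harmless: no pole of \<open>h\<close> lies between \<open>g\<close> and \<open>g + 1\<close>.\<close>

lemma line_contour_integral_translate:
  assumes vc: "vertical_contour g" and U: "open U" "h holomorphic_on U"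
    and fin: "\<And>K. finite {p \<in> - U. \<bar>Re p\<bar> \<le> K}"
    and side: "\<And>p. p \<notin> U \<Longrightarrow> (right_of_contour g p \<and> right_of_contour g (p - 1))
                              \<or> (left_of_contour g p \<and> left_of_contour g (p - 1))"
    and d: "d > 0"
    and bound: "\<And>z. 0 \<le> Re z \<Longrightarrow> Re z \<le> 1 \<Longrightarrow> T0 \<le> \<bar>Im z\<bar> \<Longrightarrow> norm (h z) \<le> C * exp (- d * \<bar>Im z\<bar>)"
  shows "has_line_contour_integral (\<lambda>z. h z - h (z + 1)) 0 g"
proof -
  have gU: "range g \<subseteq> U" using side contour_avoids by blast
  have gU1: "range g \<subseteq> {z. z + 1 \<in> U}"
  proof (rule subsetI, rule ccontr)
    fix z assume "z \<in> range g" "z \<notin> {z. z + 1 \<in> U}"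
    then show False using side[of "z + 1"] contour_avoids[of g z] by auto
  qed
  have U1: "open {z. z + 1 \<in> U}"
  proof -
    have "open ((\<lambda>z. z + 1) -` U)" by (intro open_vimage U(1) continuous_intros)
    then show ?thesis by (simp add: vimage_def)
  qed
  have "h \<circ> (\<lambda>z. z + 1) holomorphic_on {z. z + 1 \<in> U}"
    by (rule holomorphic_on_compose_gen[OF _ U(2)]) (auto intro!: holomorphic_intros)
  then have h1: "(\<lambda>z. h (z + 1)) holomorphic_on {z. z + 1 \<in> U}" by (simp add: o_def)
  let ?F = "\<lambda>t. h (g t) * vector_derivative g (at t)"
  let ?F1 = "\<lambda>t. h (g t + 1) * vector_derivative g (at t)"
  \<comment> \<open>For large |t| the contour and its translate run along the two edges Re z = 0 and
    Re z = 1 of the strip in which \<open>bound\<close> holds.\<close>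
  have F: "?F integrable_on UNIV"
    using bound[of "\<i> * of_real _"]
    by (intro line_contour_integrable[OF vc U gU d, of T0 C]) auto
  have F1: "?F1 integrable_on UNIV"
    using bound[of "\<i> * of_real _ + 1"]
    by (intro line_contour_integrable[OF vc U1 h1 gU1 d, of T0 C]) auto
  have lim0: "((\<lambda>T. C * exp (- d * T)) \<longlongrightarrow> 0) at_top"
    using d by real_asymp
  have "\<forall>\<^sub>F T in at_top. \<forall>z. 0 \<le> Re z \<longrightarrow> Re z \<le> 1 \<longrightarrow> \<bar>Im z\<bar> = T \<longrightarrow> norm (h z) \<le> e" if "e > 0" for e
    using order_tendstoD(2)[OF lim0 that] eventually_ge_at_top[of T0]
    by eventually_elim (use bound in force)
  from contour_integral_translate_tendsto[OF vc U fin side this]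
  have "((\<lambda>T. contour_integral (subpath (-T) T g) h
             - contour_integral (subpath (-T) T g) (\<lambda>z. h (z + 1))) \<longlongrightarrow> 0) at_top" by blast
  moreover have "\<forall>\<^sub>F T in at_top. contour_integral (subpath (-T) T g) h
             - contour_integral (subpath (-T) T g) (\<lambda>z. h (z + 1))
        = integral {-T..T} ?F - integral {-T..T} ?F1"
    using eventually_gt_at_top[of 0]
  proof eventually_elim
    case (elim T)
    then show ?case
      using has_integral_truncated_contour[OF vc U gU, of "-T" T] has_integral_truncated_contour[OF vc U1 h1 gU1, of "-T" T]
      by (simp add: integral_unique)
  qed
  ultimately have "((\<lambda>T. integral {-T..T} ?F - integral {-T..T} ?F1) \<longlongrightarrow> 0) at_top"
    by (rule Lim_transform_eventually)
  moreover have "((\<lambda>T. integral {-T..T} ?F - integral {-T..T} ?F1)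
      \<longlongrightarrow> integral UNIV ?F - integral UNIV ?F1) at_top"
    by (intro tendsto_diff integral_symmetric_tendsto F F1)
  ultimately have "integral UNIV ?F - integral UNIV ?F1 = 0"
    using tendsto_unique trivial_limit_at_top_linorder by blast
  then show ?thesis
    using has_integral_diff[OF integrable_integral[OF F] integrable_integral[OF F1]]
    by (simp add: has_line_contour_integral_def left_diff_distrib)
qed

section \<open>Functionals satisfying a Pearson equation\<close>

lemma poly_pochhammer: "poly (pochhammer q k) z = pochhammer (poly q z) k"
  for q :: "'a::comm_ring_1 poly"
  by (induction k) (auto simp: pochhammer_Suc algebra_simps)

lemma poly_eqI_poly: "(\<And>z. poly p z = poly q z) \<Longrightarrow> p = q"
  for p q :: "complex poly"
  by (simp add: poly_eq_poly_eq_iff[symmetric] fun_eq_iff)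

text \<open>Here \<open>J\<close> is an abstract moment functional; \<open>pearson\<close> is the adjoint form of the Pearson equation
  \<open>(z + 1) w (z + 1) = c (\<beta> + z) w z\<close> of its weight.\<close>

lemma pearson_functional_pochhammer:
  fixes J :: "complex poly \<Rightarrow> complex"
  assumes c: "c \<noteq> 1"
    and add: "\<And>p q. J (p + q) = J p + J q"
    and smult: "\<And>a p. J (smult a p) = a * J p"
    and pearson: "\<And>p. J ([:0, 1:] * p - smult c ([:\<beta>, 1:] * pcompose p [:1, 1:])) = 0"
  shows "J (pochhammer [:0, -1:] k * pochhammer [:\<beta>, 1:] j)
       = (c / (c - 1)) ^ k * pochhammer (\<beta> + of_nat j) k * J (pochhammer [:\<beta>, 1:] j)"
proof (induction k)
  case (Suc k)
  let ?B = "pochhammer [:\<beta>, 1:] j"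
  \<comment> \<open>Chosen so that \<open>z (1 - z)_k = - (-z)_(k+1)\<close>, while the shift turns
    \<open>(1 - z)_k\<close> into \<open>(-z)_k\<close> and
    \<open>(\<beta> + z) (\<beta> + z + 1)_j\<close> reproduces \<open>(\<beta> + z)_j\<close> with
    the factor \<open>\<beta> + z + j\<close>. Splitting this factor as
    \<open>(\<beta> + j + k) - (k - z)\<close> gives a two-term recursion in
    \<open>k\<close>.\<close>
  let ?p = "pochhammer [:1, -1:] k * ?B"
  have "[:0, 1:] * ?p - smult c ([:\<beta>, 1:] * pcompose ?p [:1, 1:])
      = smult (c - 1) (pochhammer [:0, -1:] (Suc k) * ?B)
        + smult (- c * (\<beta> + of_nat j + of_nat k)) (pochhammer [:0, -1:] k * ?B)"
  proof (rule poly_eqI_poly)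
    fix z :: complex
    have 1: "z * pochhammer (1 - z) k = - pochhammer (- z) (Suc k)"
      by (simp add: pochhammer_rec uminus_add_conv_diff)
    have 2: "(\<beta> + z) * pochhammer (\<beta> + z + 1) j = (\<beta> + z + of_nat j) * pochhammer (\<beta> + z) j"
      by (metis pochhammer_rec pochhammer_Suc mult.commute)
    have 3: "pochhammer (- z) (Suc k) = (of_nat k - z) * pochhammer (- z) k"
      by (simp add: pochhammer_Suc mult.commute)
    have "poly ([:0, 1:] * ?p - smult c ([:\<beta>, 1:] * pcompose ?p [:1, 1:])) z
        = (z * pochhammer (1 - z) k) * pochhammer (\<beta> + z) j
          - c * (((\<beta> + z) * pochhammer (\<beta> + z + 1) j) * pochhammer (- z) k)"
      by (simp add: poly_pochhammer poly_pcompose algebra_simps)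
    also have "\<dots> = poly (smult (c - 1) (pochhammer [:0, -1:] (Suc k) * ?B)
        + smult (- c * (\<beta> + of_nat j + of_nat k)) (pochhammer [:0, -1:] k * ?B)) z"
      unfolding 1 2 by (simp add: poly_pochhammer 3 algebra_simps)
    finally show "poly ([:0, 1:] * ?p - smult c ([:\<beta>, 1:] * pcompose ?p [:1, 1:])) z = \<dots>" .
  qed
  then have "(c - 1) * J (pochhammer [:0, -1:] (Suc k) * ?B)
      = c * (\<beta> + of_nat j + of_nat k) * J (pochhammer [:0, -1:] k * ?B)"
    using pearson[of ?p] by (simp add: add smult algebra_simps del: pochhammer_Suc)
  then have "J (pochhammer [:0, -1:] (Suc k) * ?B)
      = c / (c - 1) * (\<beta> + of_nat j + of_nat k) * J (pochhammer [:0, -1:] k * ?B)"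
    using c by (simp add: field_simps)
  then show ?case
    unfolding Suc.IH by (simp add: pochhammer_Suc mult_ac)
qed simp

text \<open>Against \<open>pochhammer [:\<beta>, 1:] j\<close> the powers of
  \<open>c / (c - 1)\<close> cancel those in the Meixner sum, leaving an \<open>n\<close>-th
  difference of a polynomial of degree \<open>j < n\<close>. Powers of \<open>z\<close> are then
  expressed through these rising factorials.\<close>

lemma pearson_functional_meixner:
  fixes J :: "complex poly \<Rightarrow> complex"
  assumes c: "c \<noteq> 0" "c \<noteq> 1" and \<beta>: "- \<beta> \<notin> \<nat>"
    and add: "\<And>p q. J (p + q) = J p + J q"
    and smult: "\<And>a p. J (smult a p) = a * J p"
    and pearson: "\<And>p. J ([:0, 1:] * p - smult c ([:\<beta>, 1:] * pcompose p [:1, 1:])) = 0"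
    and M: "\<And>z. poly M z = meixner n \<beta> c z"
    and mn: "m < n"
  shows "J (M * monom 1 m) = 0"
proof -
  define K where "K = c ^ n * pochhammer \<beta> n / (c - 1) ^ n"
  define a where "a k = K * ((-1) ^ k * of_nat (n choose k) / pochhammer \<beta> k * ((c - 1) / c) ^ k)" for k
  have pnz: "pochhammer \<beta> k \<noteq> 0" for k
    using \<beta> by (auto simp: pochhammer_eq_0_iff)
  have sum: "J (sum f S) = (\<Sum>k\<in>S. J (f k))" if "finite S" for f :: "nat \<Rightarrow> complex poly" and S
    using that smult[of 0 0] by (induction S rule: finite_induct) (auto simp: add)
  \<comment> \<open>The previous fact used \<open>smult\<close> with scalar 0 to get
    \<open>J 0 = 0\<close>, the empty sum. The task is now the basis of rising factorials in
    \<open>\<beta> + z\<close>.\<close>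
  have MB: "J (M * pochhammer [:\<beta>, 1:] j) = 0" if "j < n" for j
  proof -
    have "M * pochhammer [:\<beta>, 1:] j
        = (\<Sum>k\<le>n. smult (a k) (pochhammer [:0, -1:] k * pochhammer [:\<beta>, 1:] j))"
      by (rule poly_eqI_poly)
         (simp add: M meixner_eq_sum[OF c] poly_sum poly_pochhammer a_def K_def sum_distrib_left sum_distrib_right mult_ac)
    then have "J (M * pochhammer [:\<beta>, 1:] j)
        = (\<Sum>k\<le>n. a k * ((c / (c - 1)) ^ k * pochhammer (\<beta> + of_nat j) k * J (pochhammer [:\<beta>, 1:] j)))"
      by (simp add: sum smult pearson_functional_pochhammer[OF c(2) add smult pearson])
    also have "\<dots> = (\<Sum>k\<le>n. K * J (pochhammer [:\<beta>, 1:] j) / pochhammer \<beta> j *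
         ((-1) ^ k * of_nat (n choose k) * pochhammer (\<beta> + of_nat k) j))"
    proof (rule sum.cong[OF refl])
      fix k
      \<comment> \<open>Both products equal \<open>pochhammer \<beta> (j + k)\<close>. Exchanging
        the indices makes the dependence on \<open>k\<close> polynomial of degree
        \<open>j\<close>.\<close>
      have "pochhammer \<beta> j * pochhammer (\<beta> + of_nat j) k = pochhammer \<beta> k * pochhammer (\<beta> + of_nat k) j"
        by (metis pochhammer_product' add.commute)
      then have *: "pochhammer (\<beta> + of_nat j) k / pochhammer \<beta> k = pochhammer (\<beta> + of_nat k) j / pochhammer \<beta> j"
        using pnz by (simp add: frac_eq_eq mult_ac)
      have inv: "((c - 1) / c) ^ k * (c / (c - 1)) ^ k = 1"
        using c by (simp flip: power_mult_distrib)
      have "K * (s * b / q * r) * (x * u * y) = (r * x) * (K * s * b * (u / q) * y)"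
        for s b q r x u y :: complex by simp
      then have "a k * ((c / (c - 1)) ^ k * pochhammer (\<beta> + of_nat j) k * J (pochhammer [:\<beta>, 1:] j))
         = K * (-1) ^ k * of_nat (n choose k) * (pochhammer (\<beta> + of_nat j) k / pochhammer \<beta> k) * J (pochhammer [:\<beta>, 1:] j)"
        unfolding a_def using inv by (simp only:) simp
      then show "a k * ((c / (c - 1)) ^ k * pochhammer (\<beta> + of_nat j) k * J (pochhammer [:\<beta>, 1:] j))
         = K * J (pochhammer [:\<beta>, 1:] j) / pochhammer \<beta> j *
           ((-1) ^ k * of_nat (n choose k) * pochhammer (\<beta> + of_nat k) j)"
        unfolding * by simp
    qed
    also have "\<dots> = 0"
      unfolding sum_distrib_left[symmetric] alternating_sum_pochhammer_eq_0[OF that] by simp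
    finally show ?thesis .
  qed
  \<comment> \<open>One factor \<open>z\<close> is traded through
    \<open>z = (\<beta> + z + j) - (\<beta> + j)\<close>: the first term raises \<open>j\<close>,
    the second keeps it, and \<open>m + j < n\<close> is preserved.\<close>
  have "J (M * monom 1 m * pochhammer [:\<beta>, 1:] j) = 0" if "m + j < n" for j
    using that
  proof (induction m arbitrary: j)
    case 0
    then show ?case using MB by simp
  next
    case (Suc m)
    have "M * monom 1 (Suc m) * pochhammer [:\<beta>, 1:] j
       = M * monom 1 m * pochhammer [:\<beta>, 1:] (Suc j)
         + smult (- (\<beta> + of_nat j)) (M * monom 1 m * pochhammer [:\<beta>, 1:] j)"
      by (rule poly_eqI_poly) (simp add: poly_pochhammer poly_monom pochhammer_Suc algebra_simps)
    then show ?case using Suc.IH[of "Suc j"] Suc.IH[of j] Suc.prems by (simp add: add smult)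
  qed
  from this[of 0] mn show ?thesis by simp
qed

section \<open>Orthogonality\<close>

text \<open>Induction along Horner's scheme: the factor \<open>z\<close> costs half of the rate
  \<open>e\<close>, so the rate stays general.\<close>

lemma norm_poly_strip_le:
  fixes p :: "complex poly"
  assumes "e > 0"
  shows "\<exists>K\<ge>0. \<forall>z. 0 \<le> Re z \<longrightarrow> Re z \<le> 1 \<longrightarrow> norm (poly p z) \<le> K * exp (e * \<bar>Im z\<bar>)"
  using assms
proof (induction p arbitrary: e)
  case 0
  then show ?case by (intro exI[of _ 0]) auto
next
  case (pCons a p)
  obtain K where K: "K \<ge> 0" "\<And>z. 0 \<le> Re z \<Longrightarrow> Re z \<le> 1 \<Longrightarrow> norm (poly p z) \<le> K * exp (e / 2 * \<bar>Im z\<bar>)"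
    using pCons.IH[of "e / 2"] pCons.prems by (metis half_gt_zero)
  have "norm (poly (pCons a p) z) \<le> (norm a + (1 + 2 / e) * K) * exp (e * \<bar>Im z\<bar>)"
    if z: "0 \<le> Re z" "Re z \<le> 1" for z
  proof -
    let ?y = "\<bar>Im z\<bar>"
    have e2: "exp (e / 2 * ?y) \<ge> 1" "exp (e * ?y) \<ge> 1" using pCons.prems by auto
    have "norm z \<le> 1 + ?y" using cmod_le[of z] z by linarith
    also have "\<dots> \<le> exp (e / 2 * ?y) + exp (e / 2 * ?y) / (e / 2)"
      using e2 le_exp_mult[of "e / 2" ?y] pCons.prems by (intro add_mono) auto
    also have "\<dots> = (1 + 2 / e) * exp (e / 2 * ?y)" by (simp add: field_simps)
    finally have nz: "norm z \<le> (1 + 2 / e) * exp (e / 2 * ?y)" .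
    have "norm (poly (pCons a p) z) \<le> norm a + norm z * norm (poly p z)"
      by (simp add: norm_triangle_ineq flip: norm_mult)
    also have "\<dots> \<le> norm a * exp (e * ?y) + ((1 + 2 / e) * exp (e / 2 * ?y)) * (K * exp (e / 2 * ?y))"
      using nz K z e2 pCons.prems mult_left_mono[OF e2(2), of "norm a"] by (intro add_mono mult_mono) auto
    also have "\<dots> = norm a * exp (e * ?y) + (1 + 2 / e) * K * exp (e / 2 * ?y + e / 2 * ?y)"
      by (simp only: exp_add mult_ac)
    also have "e / 2 * ?y + e / 2 * ?y = e * ?y" by simp
    finally show ?thesis by (simp add: distrib_right)
  qed
  then show ?case using K(1) pCons.prems by (intro exI[of _ "norm a + (1 + 2 / e) * K"]) auto
qed

lemma abs_Arg_less_pi: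
  assumes "z \<notin> \<real>\<^sub>\<le>\<^sub>0"
  shows "\<bar>Arg z\<bar> < pi"
proof -
  have "z \<noteq> 0" using assms by auto
  then have "Arg z = Im (Ln z)" by (rule Arg_eq_Im_Ln)
  then show ?thesis
    using mpi_less_Im_Ln[OF \<open>z \<noteq> 0\<close>] Im_Ln_le_pi[OF \<open>z \<noteq> 0\<close>] Im_Ln_eq_pi[OF \<open>z \<noteq> 0\<close>] assms
    by (auto simp: complex_nonpos_Reals_iff)
qed

text \<open>The two Gamma factors decay with total rate 2 \<theta>, which may be anything below pi,
  and \<open>(- c) powr z\<close> grows at most with rate |Arg (- c)| < pi. The case
  \<open>k = 0\<close> serves integrability of the weight, \<open>k = 1\<close> the function that is
  translated.\<close>

lemma weight_strip_decay:
  assumes c: "c \<notin> \<real>\<^sub>\<ge>\<^sub>0"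
  obtains C d T0 where "d > 0"
    "\<And>z. 0 \<le> Re z \<Longrightarrow> Re z \<le> 1 \<Longrightarrow> T0 \<le> \<bar>Im z\<bar> \<Longrightarrow>
       norm (poly p z * Gamma (of_nat k - z) * Gamma (\<beta> + z) * (- c) powr z) \<le> C * exp (- d * \<bar>Im z\<bar>)"
proof -
  \<comment> \<open>\<theta> is the midpoint of \<alpha> / 2 and pi / 2, so 2 \<theta> - \<alpha> =
    2 d: one \<open>d\<close> absorbs the polynomial and the other remains as the decay
    rate.\<close>
  define \<alpha> where "\<alpha> = \<bar>Arg (- c)\<bar>"
  define d where "d = (pi - \<alpha>) / 4"
  define \<theta> where "\<theta> = (pi + \<alpha>) / 4"
  have "- c \<notin> \<real>\<^sub>\<le>\<^sub>0" using c by (auto simp: complex_nonpos_Reals_iff complex_nonneg_Reals_iff)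
  then have "\<alpha> < pi" unfolding \<alpha>_def by (rule abs_Arg_less_pi)
  then have d: "d > 0" and \<theta>: "\<theta> < pi / 2" "\<theta> > 0" by (auto simp: d_def \<theta>_def \<alpha>_def)
  have c0: "norm c > 0" using c by auto
  obtain K where K: "K \<ge> 0" "\<And>z. 0 \<le> Re z \<Longrightarrow> Re z \<le> 1 \<Longrightarrow> norm (poly p z) \<le> K * exp (d * \<bar>Im z\<bar>)"
    using norm_poly_strip_le[OF d] by metis
  obtain C1 where C1: "C1 \<ge> 0" "\<And>z. real k - 1 \<le> Re z \<Longrightarrow> Re z \<le> real k \<Longrightarrow> 1 \<le> \<bar>Im z\<bar>
      \<Longrightarrow> norm (Gamma z) \<le> C1 * exp (- \<theta> * \<bar>Im z\<bar>)"
    using norm_Gamma_strip_le[OF \<theta>(1)] by metis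
  obtain C2 where C2: "C2 \<ge> 0" "\<And>z. Re \<beta> \<le> Re z \<Longrightarrow> Re z \<le> Re \<beta> + 1 \<Longrightarrow> 1 \<le> \<bar>Im z\<bar>
      \<Longrightarrow> norm (Gamma z) \<le> C2 * exp (- \<theta> * \<bar>Im z\<bar>)"
    using norm_Gamma_strip_le[OF \<theta>(1)] by metis
  define C3 where "C3 = max 1 (norm c)"
  have "norm (poly p z * Gamma (of_nat k - z) * Gamma (\<beta> + z) * (- c) powr z)
      \<le> (K * C1 * (C2 * exp (\<theta> * \<bar>Im \<beta>\<bar>)) * C3) * exp (- d * \<bar>Im z\<bar>)"
    \<comment> \<open>The height also ensures |Im (\<beta> + z)| \<ge> 1, as the estimate of the
      second Gamma factor requires.\<close>
    if z: "0 \<le> Re z" "Re z \<le> 1" "1 + \<bar>Im \<beta>\<bar> \<le> \<bar>Im z\<bar>" for z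
  proof -
    let ?y = "\<bar>Im z\<bar>"
    have 1: "norm (poly p z) \<le> K * exp (d * ?y)" using K z by blast
    have 2: "norm (Gamma (of_nat k - z)) \<le> C1 * exp (- \<theta> * ?y)"
      using C1(2)[of "of_nat k - z"] z by simp
    have 3: "norm (Gamma (\<beta> + z)) \<le> C2 * exp (\<theta> * \<bar>Im \<beta>\<bar>) * exp (- \<theta> * ?y)"
    proof -
      have y: "\<bar>Im (\<beta> + z)\<bar> \<ge> ?y - \<bar>Im \<beta>\<bar>" by simp
      have "norm (Gamma (\<beta> + z)) \<le> C2 * exp (- \<theta> * \<bar>Im (\<beta> + z)\<bar>)"
        using z y by (intro C2) auto
      also have "\<dots> \<le> C2 * exp (\<theta> * \<bar>Im \<beta>\<bar> + - \<theta> * ?y)"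
        using mult_left_mono[OF y, of \<theta>] \<theta> C2(1) by (intro mult_left_mono) (auto simp: algebra_simps)
      finally show ?thesis by (simp only: exp_add mult.assoc)
    qed
    have 4: "norm ((- c) powr z) \<le> C3 * exp (\<alpha> * ?y)"
    proof -
      have "norm c powr Re z \<le> C3 powr Re z" using z c0 by (intro powr_mono2) (auto simp: C3_def)
      also have "\<dots> \<le> C3 powr 1" using z by (intro powr_mono) (auto simp: C3_def)
      finally have "norm c powr Re z \<le> C3" by (simp add: C3_def)
      moreover have "- Im z * Arg (- c) \<le> \<alpha> * ?y"
        unfolding \<alpha>_def by (metis abs_ge_self abs_minus_cancel abs_mult mult.commute)
      ultimately show ?thesis unfolding norm_powr_complex
        by (intro mult_mono) (auto simp: C3_def)
    qed
    have "norm (poly p z * Gamma (of_nat k - z) * Gamma (\<beta> + z) * (- c) powr z)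
      \<le> (K * exp (d * ?y)) * (C1 * exp (- \<theta> * ?y)) * (C2 * exp (\<theta> * \<bar>Im \<beta>\<bar>) * exp (- \<theta> * ?y)) * (C3 * exp (\<alpha> * ?y))"
      unfolding norm_mult using 1 2 3 4 K(1) C1(1) C2(1)
      by (intro mult_mono mult_nonneg_nonneg norm_ge_zero) auto
    also have "\<dots> = (K * C1 * (C2 * exp (\<theta> * \<bar>Im \<beta>\<bar>)) * C3)
        * (exp (d * ?y) * exp (- \<theta> * ?y) * exp (- \<theta> * ?y) * exp (\<alpha> * ?y))" by simp
    also have "exp (d * ?y) * exp (- \<theta> * ?y) * exp (- \<theta> * ?y) * exp (\<alpha> * ?y) = exp ((d - \<theta> - \<theta> + \<alpha>) * ?y)"
      by (simp add: algebra_simps flip: exp_add)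
    also have "d - \<theta> - \<theta> + \<alpha> = - d" by (simp add: d_def \<theta>_def field_simps)
    finally show ?thesis .
  qed
  then show ?thesis using that d by blast
qed

theorem propositionA1:
  fixes \<beta> c :: complex and \<gamma> :: "real \<Rightarrow> complex" and n m :: nat
  assumes "c \<notin> \<real>\<^sub>\<ge>\<^sub>0"
    and "- \<beta> \<notin> \<nat>"
    and "separating_contour \<beta> \<gamma>"
    and "m < n"
  shows "has_line_contour_integral
           (\<lambda>z. meixner n \<beta> c z * z ^ m * Gamma (- z) * Gamma (\<beta> + z) * (- c) powr z) 0 \<gamma>"
proof -
  have c: "c \<noteq> 0" "c \<noteq> 1" "- c \<noteq> 0" using assms(1) by auto
  have vc: "vertical_contour \<gamma>" and right: "right_of_contour \<gamma> (of_nat k)"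
    and left: "left_of_contour \<gamma> (- \<beta> - of_nat k)" for k
    using assms(3) by (auto simp: separating_contour_def)
  have regular: "- \<gamma> t \<notin> \<int>\<^sub>\<le>\<^sub>0" "\<beta> + \<gamma> t \<notin> \<int>\<^sub>\<le>\<^sub>0" for t
  proof -
    have "\<gamma> t \<noteq> of_nat k" "\<gamma> t \<noteq> - \<beta> - of_nat k" for k
      using contour_avoids[of \<gamma>] right[of k] left[of k] by (metis rangeI)+
    moreover have "\<gamma> t = - \<beta> - of_nat k" if "\<beta> + \<gamma> t = - of_nat k" for k
      using that by algebra
    ultimately have "- \<gamma> t \<noteq> - of_nat k" "\<beta> + \<gamma> t \<noteq> - of_nat k" for k
      by (simp, blast)
    then show "- \<gamma> t \<notin> \<int>\<^sub>\<le>\<^sub>0" "\<beta> + \<gamma> t \<notin> \<int>\<^sub>\<le>\<^sub>0"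
      by (meson nonpos_Ints_cases')+
  qed
  define w where "w z = Gamma (- z) * Gamma (\<beta> + z) * (- c) powr z" for z
  define F where "F p t = poly p (\<gamma> t) * w (\<gamma> t) * vector_derivative \<gamma> (at t)" for p t
  define J where "J p = integral UNIV (F p)" for p
  \<comment> \<open>Needed before \<open>J\<close> can be additive, and at the end to turn the value
    \<open>J = 0\<close> into convergence of the improper integral to 0.\<close>
  have integrable: "F p integrable_on UNIV" for p
  proof -
    define U where "U = {z. - z \<notin> \<int>\<^sub>\<le>\<^sub>0} \<inter> {z. \<beta> + z \<notin> \<int>\<^sub>\<le>\<^sub>0}"
    obtain C d T0 where d: "d > 0" and bound:
      "\<And>z. 0 \<le> Re z \<Longrightarrow> Re z \<le> 1 \<Longrightarrow> T0 \<le> \<bar>Im z\<bar> \<Longrightarrow>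
         norm (poly p z * Gamma (of_nat 0 - z) * Gamma (\<beta> + z) * (- c) powr z) \<le> C * exp (- d * \<bar>Im z\<bar>)"
      using weight_strip_decay[OF assms(1), where p = p and k = 0 and \<beta> = \<beta>] by metis
    have "(\<lambda>t. poly p (\<gamma> t) * w (\<gamma> t) * vector_derivative \<gamma> (at t)) integrable_on UNIV"
    proof (rule line_contour_integrable[OF vc _ _ _ d])
      have "open (uminus -` (- \<int>\<^sub>\<le>\<^sub>0) :: complex set)" "open ((+) \<beta> -` (- \<int>\<^sub>\<le>\<^sub>0))"
        by (intro open_vimage continuous_intros; simp add: open_Compl)+
      then show "open U" unfolding U_def by (intro open_Int) (simp_all add: vimage_def)
      show "(\<lambda>z. poly p z * w z) holomorphic_on U"
        unfolding w_def using c by (intro holomorphic_intros) (auto simp: U_def)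
      show "range \<gamma> \<subseteq> U" using regular by (auto simp: U_def)
      show "norm (poly p (\<i> * of_real t) * w (\<i> * of_real t)) \<le> C * exp (- d * \<bar>t\<bar>)" if "T0 \<le> \<bar>t\<bar>" for t
        using bound[of "\<i> * of_real t"] that by (simp add: w_def mult.assoc)
    qed
    then show ?thesis by (simp add: F_def [abs_def])
  qed
  have add: "J (p + q) = J p + J q" for p q
    using integral_add[OF integrable integrable, of p q]
    by (simp add: J_def F_def[abs_def] distrib_right)
  have smult: "J (smult a p) = a * J p" for a p
  proof -
    have "F (smult a p) = (\<lambda>t. a * F p t)" by (simp add: F_def[abs_def] mult.assoc)
    then show ?thesis by (simp add: J_def)
  qed
  have pearson: "J ([:0, 1:] * p - smult c ([:\<beta>, 1:] * pcompose p [:1, 1:])) = 0" for p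
  proof -
    \<comment> \<open>Up to sign \<open>h\<close> contains \<open>Gamma (1 - z)\<close>, that is
      \<open>z Gamma (- z)\<close> with the singularity at 0 removed. So the right poles start at 1,
      and for every pole \<open>z\<close> the point \<open>z - 1\<close> is still on the same side
      of the contour.\<close>
    define U where "U = {z. 1 - z \<notin> \<int>\<^sub>\<le>\<^sub>0} \<inter> {z. \<beta> + z \<notin> \<int>\<^sub>\<le>\<^sub>0}"
    define h where "h z = - (poly p z * Gamma (of_nat 1 - z) * Gamma (\<beta> + z) * (- c) powr z)" for z
    obtain C d T0 where d: "d > 0" and bound:
      "\<And>z. 0 \<le> Re z \<Longrightarrow> Re z \<le> 1 \<Longrightarrow> T0 \<le> \<bar>Im z\<bar> \<Longrightarrow>
         norm (poly p z * Gamma (of_nat 1 - z) * Gamma (\<beta> + z) * (- c) powr z) \<le> C * exp (- d * \<bar>Im z\<bar>)"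
      using weight_strip_decay[OF assms(1), where p = p and k = 1 and \<beta> = \<beta>] by metis
    have poles: "(\<exists>k. z = of_nat (Suc k)) \<or> (\<exists>k. z = - \<beta> - of_nat k)" if zU: "z \<notin> U" for z
    proof -
      consider "1 - z \<in> \<int>\<^sub>\<le>\<^sub>0" | "\<beta> + z \<in> \<int>\<^sub>\<le>\<^sub>0" using zU unfolding U_def by blast
      then show ?thesis
      proof cases
        case 1
        then obtain k where "1 - z = - of_nat k" by (elim nonpos_Ints_cases')
        then have "z = 1 + of_nat k" by algebra
        then have "z = of_nat (Suc k)" by simp
        then show ?thesis by blast
      next
        case 2
        then obtain k where "\<beta> + z = - of_nat k" by (elim nonpos_Ints_cases')
        then have "z = - \<beta> - of_nat k" by algebra
        then show ?thesis by blast
      qed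
    qed
    have "has_line_contour_integral (\<lambda>z. h z - h (z + 1)) 0 \<gamma>"
    proof (rule line_contour_integral_translate[OF vc _ _ _ _ d])
      have "open ((-) 1 -` (- \<int>\<^sub>\<le>\<^sub>0) :: complex set)" "open ((+) \<beta> -` (- \<int>\<^sub>\<le>\<^sub>0))"
        by (intro open_vimage continuous_intros; simp add: open_Compl)+
      then show "open U" unfolding U_def by (intro open_Int) (simp_all add: vimage_def)
      show "h holomorphic_on U"
        unfolding h_def using c by (intro holomorphic_intros) (auto simp: U_def)
      show "finite {z \<in> - U. \<bar>Re z\<bar> \<le> K}" for K
      proof -
        obtain N :: nat where N: "K + norm \<beta> \<le> real N" using real_arch_simple by blast
        have "{z \<in> - U. \<bar>Re z\<bar> \<le> K} \<subseteq> (\<lambda>k. of_nat (Suc k)) ` {..N} \<union> (\<lambda>k. - \<beta> - of_nat k) ` {..N}"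
        proof
          fix z assume z: "z \<in> {z \<in> - U. \<bar>Re z\<bar> \<le> K}"
          then have zK: "\<bar>Re z\<bar> \<le> K" by blast
          consider k where "z = of_nat (Suc k)" | k where "z = - \<beta> - of_nat k"
            using poles z by blast
          then show "z \<in> (\<lambda>k. of_nat (Suc k)) ` {..N} \<union> (\<lambda>k. - \<beta> - of_nat k) ` {..N}"
          proof cases
            case 1
            then have "\<bar>Re z\<bar> = 1 + real k" by simp
            then have "real k \<le> real N" using zK N norm_ge_zero[of \<beta>] by linarith
            then show ?thesis using 1 by auto
          next
            case 2
            then have "real k \<le> \<bar>Re z\<bar> + \<bar>Re \<beta>\<bar>" by simp
            then have "real k \<le> real N" using zK N abs_Re_le_cmod[of \<beta>] by linarith
            then show ?thesis using 2 by auto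
          qed
        qed
        then show ?thesis by (rule finite_subset) auto
      qed
      show "(right_of_contour \<gamma> z \<and> right_of_contour \<gamma> (z - 1))
          \<or> (left_of_contour \<gamma> z \<and> left_of_contour \<gamma> (z - 1))" if "z \<notin> U" for z
        using poles[OF that]
      proof
        assume "\<exists>k. z = of_nat (Suc k)"
        then obtain k where k: "z = of_nat (Suc k)" by blast
        then have "z - 1 = of_nat k" by simp
        then show ?thesis using right k by metis
      next
        assume "\<exists>k. z = - \<beta> - of_nat k"
        then obtain k where k: "z = - \<beta> - of_nat k" by blast
        then have "z - 1 = - \<beta> - of_nat (Suc k)" by simp
        then show ?thesis using left k by metis
      qed
      show "norm (h z) \<le> C * exp (- d * \<bar>Im z\<bar>)" if "0 \<le> Re z" "Re z \<le> 1" "T0 \<le> \<bar>Im z\<bar>" for z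
        using bound[OF that] by (simp add: h_def)
    qed
    \<comment> \<open>The functional equations turn \<open>h z\<close> into
      \<open>z p(z) w(z)\<close> and \<open>h (z + 1)\<close> into
      \<open>c (\<beta> + z) p(z + 1) w(z)\<close>; the sign of \<open>h\<close> combines with the
      base \<open>- c\<close> of the power.\<close>
    moreover have "h z - h (z + 1) = poly ([:0, 1:] * p - smult c ([:\<beta>, 1:] * pcompose p [:1, 1:])) z * w z"
      if z: "- z \<notin> \<int>\<^sub>\<le>\<^sub>0" "\<beta> + z \<notin> \<int>\<^sub>\<le>\<^sub>0" for z
    proof -
      have "Gamma (1 - z) = - z * Gamma (- z)"
        using Gamma_plus1[OF z(1)] by (simp add: uminus_add_conv_diff)
      moreover have "Gamma (\<beta> + (z + 1)) = (\<beta> + z) * Gamma (\<beta> + z)"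
        using Gamma_plus1[OF z(2)] by (simp add: add.assoc)
      ultimately show ?thesis using c
        by (simp add: h_def w_def poly_pcompose powr_add algebra_simps)
    qed
    ultimately have "(F ([:0, 1:] * p - smult c ([:\<beta>, 1:] * pcompose p [:1, 1:])) has_integral 0) UNIV"
      using regular
      by (simp add: has_line_contour_integral_def F_def[abs_def])
    then show ?thesis by (simp add: J_def integral_unique)
  qed
  \<comment> \<open>The Meixner polynomial as an element of \<open>complex poly\<close>, on which
    \<open>J\<close> acts.\<close>
  define M where "M = (\<Sum>k\<le>n. smult (c ^ n * pochhammer \<beta> n / (c - 1) ^ n *
      ((-1) ^ k * of_nat (n choose k) / pochhammer \<beta> k * ((c - 1) / c) ^ k)) (pochhammer [:0, -1:] k))"
  have M: "poly M z = meixner n \<beta> c z" for z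
    by (simp add: M_def meixner_eq_sum[OF c(1,2)] poly_sum poly_pochhammer)
  have "J (M * monom 1 m) = 0"
    by (rule pearson_functional_meixner[OF c(1,2) assms(2) add smult pearson M assms(4)])
  then have "(F (M * monom 1 m) has_integral 0) UNIV"
    using integrable_integral[OF integrable] by (metis J_def)
  then show ?thesis
    by (simp add: has_line_contour_integral_def F_def[abs_def] M poly_monom w_def mult.assoc)
qed

end
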